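(* Let $\Delta \ge 3$ be an integer and $\delta \in (0,1)$, and let $\lambda_c(\Delta) = \frac{(\Delta-1)^{\Delta-1}}{(\Delta-2)^{\Delta}}$. For every $n$-vertex graph $G$ of maximum degree $\Delta$ and every $0<\lambda \le (1-\delta)\lambda_c(\Delta)$, the mixing time of the Glauber dynamics for the hardcore model on $G$ with fugacity $\lambda$ is $O(n^{2+32/\delta})$ (the implied constant not depending on $n$ or on $G$).
   Context: The hardcore model on a finite graph $G=(V,E)$ with fugacity $\lambda>0$ is the probability distribution $\mu_G$ on independent sets $I$ of $G$ (identified with configurations $\sigma\in\{0,1\}^V$, $\sigma_v=1$ iff $v\in I$) with $\mu_G(I) \propto \lambda^{|I|}$. The Glauber dynamics is the Markov chain on independent sets which, from the current configuration $X_t$, picks a vertex $v\in V$ uniformly at random, keeps $X_{t+1}(w)=X_t(w)$ for all $w\ne v$, and draws $X_{t+1}(v)$ from the conditional distribution of $\sigma_v$ under $\mu_G$ given $\sigma_w = X_t(w)$ for all $w\neq v$ (i.e., $v$ becomes occupied with probability $\lambda/(1+\lambda)$ if no neighbor of $v$ is occupied, and unoccupied otherwise). The mixing time of a chain with transition matrix $P$ and stationary distribution $\mu$ is $\max_{x_0}\min\{t\ge 0: \|P^t(x_0,\cdot)-\mu\|_{\mathrm{TV}}\le 1/4\}$. *)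

theory Defs
  imports "HOL-Probability.Probability" "Graph_Theory.Pair_Digraph"
begin

text \<open>A chain is given by its kernel, the rows of the transition matrix being
  the probability mass functions \<^term>\<open>K x\<close>.\<close>

definition tv_dist :: "'s pmf \<Rightarrow> 's pmf \<Rightarrow> real" where
  "tv_dist p q = (SUP A. \<bar>measure_pmf.prob p A - measure_pmf.prob q A\<bar>)"

definition chain_dist :: "('s \<Rightarrow> 's pmf) \<Rightarrow> nat \<Rightarrow> 's \<Rightarrow> 's pmf" where
  "chain_dist K t x = ((\<lambda>p. bind_pmf p K) ^^ t) (return_pmf x)"

text \<open>The value is an extended natural number, so that it is \<^term>\<open>\<infinity>\<close> (and not an
  unspecified number) if from some starting state the distance never drops to 1/4.\<close>

definition mixing_time :: "'s set \<Rightarrow> ('s \<Rightarrow> 's pmf) \<Rightarrow> 's pmf \<Rightarrow> enat" where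
  "mixing_time \<Omega> K \<mu> =
     (SUP x\<in>\<Omega>. INF t\<in>{t. tv_dist (chain_dist K t x) \<mu> \<le> 1/4}. enat t)"

text \<open>Finite simple graphs are \<^const>\<open>pair_graph\<close>s: an edge is represented by its two
  opposite arcs, so the degree of a vertex is its \<^const>\<open>out_degree\<close>.\<close>

definition max_degree :: "'v pair_pre_digraph \<Rightarrow> nat" where
  "max_degree G = Max (out_degree (with_proj G) ` pverts G)"

definition independent_sets :: "'v pair_pre_digraph \<Rightarrow> 'v set set" where
  "independent_sets G = {I. I \<subseteq> pverts G \<and> (\<forall>u\<in>I. \<forall>v\<in>I. (u, v) \<notin> parcs G)}"

definition partition_function :: "'v pair_pre_digraph \<Rightarrow> real \<Rightarrow> real" where
  "partition_function G lam = (\<Sum>I\<in>independent_sets G. lam ^ card I)"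

definition hardcore :: "'v pair_pre_digraph \<Rightarrow> real \<Rightarrow> 'v set pmf" where
  "hardcore G lam =
     embed_pmf (\<lambda>I. if I \<in> independent_sets G then lam ^ card I / partition_function G lam else 0)"

text \<open>Resampling the spin at \<^term>\<open>v\<close> given all other spins of \<^term>\<open>I\<close> is drawing
  from the Gibbs measure conditioned on agreeing with \<^term>\<open>I\<close> off \<^term>\<open>v\<close>.\<close>

definition glauber :: "'v pair_pre_digraph \<Rightarrow> real \<Rightarrow> 'v set \<Rightarrow> 'v set pmf" where
  "glauber G lam I =
     bind_pmf (pmf_of_set (pverts G)) (\<lambda>v. cond_pmf (hardcore G lam) {J. J - {v} = I - {v}})"

definition hardcore_critical :: "nat \<Rightarrow> real" where
  "hardcore_critical \<Delta> = (real \<Delta> - 1) ^ (\<Delta> - 1) / (real \<Delta> - 2) ^ \<Delta>"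

lemma empty_in_independent_sets: "{} \<in> independent_sets G"
  by (simp add: independent_sets_def)

lemma independent_sets_subset: "I \<in> independent_sets G \<Longrightarrow> J \<subseteq> I \<Longrightarrow> J \<in> independent_sets G"
  by (auto simp: independent_sets_def)

lemma finite_independent_sets: "pair_graph G \<Longrightarrow> finite (independent_sets G)"
  by (rule finite_subset[of _ "Pow (pverts G)"])
    (auto simp: independent_sets_def pair_graph_def pair_digraph_def pair_fin_digraph.pair_finite_verts)

lemma partition_function_pos:
  assumes "pair_graph G" "lam > 0"
  shows "partition_function G lam > 0"
  unfolding partition_function_def
  using assms finite_independent_sets[OF assms(1)] empty_in_independent_sets[of G]
  by (intro sum_pos) auto

lemma pmf_hardcore:
  assumes "pair_graph G" "lam > 0"
  shows "pmf (hardcore G lam) I =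
    (if I \<in> independent_sets G then lam ^ card I / partition_function G lam else 0)"
proof -
  let ?f = "\<lambda>I. if I \<in> independent_sets G then lam ^ card I / partition_function G lam else 0"
  have pos: "partition_function G lam > 0" by (rule partition_function_pos[OF assms])
  have fin: "finite (independent_sets G)" by (rule finite_independent_sets[OF assms(1)])
  have nn: "0 \<le> ?f J" for J using pos assms(2) by simp
  have "(\<integral>\<^sup>+ J. ennreal (?f J) \<partial>count_space UNIV) = (\<Sum>J\<in>independent_sets G. ennreal (?f J))"
    by (rule nn_integral_count_space') (use fin in auto)
  also have "\<dots> = ennreal (\<Sum>J\<in>independent_sets G. ?f J)"
    by (rule sum_ennreal) (rule nn)
  also have "(\<Sum>J\<in>independent_sets G. ?f J) = 1"
    using pos by (simp flip: sum_divide_distrib add: partition_function_def)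
  finally have "(\<integral>\<^sup>+ J. ennreal (?f J) \<partial>count_space UNIV) = 1" by simp
  then show ?thesis unfolding hardcore_def by (intro pmf_embed_pmf nn) auto
qed

lemma set_pmf_hardcore:
  assumes "pair_graph G" "lam > 0"
  shows "set_pmf (hardcore G lam) = independent_sets G"
  using partition_function_pos[OF assms] assms(2)
  by (auto simp: set_pmf_iff pmf_hardcore[OF assms] split: if_splits)

lemma cond_hardcore_eq:
  assumes "pair_graph G" "lam > 0" "I \<in> independent_sets G" "v \<in> pverts G"
  shows "cond_pmf (hardcore G lam) {J. J - {v} = I - {v}} =
    (if \<exists>u\<in>I. (u, v) \<in> parcs G then return_pmf (I - {v})
     else map_pmf (\<lambda>b. if b then insert v I else I - {v}) (bernoulli_pmf (lam / (1 + lam))))"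
    (is "cond_pmf ?\<mu> ?S = ?R")
proof -
  interpret pair_graph G by (rule assms(1))
  let ?A = "I - {v}" and ?B = "insert v I" and ?Z = "partition_function G lam"
  have Z: "?Z > 0" by (rule partition_function_pos[OF assms(1,2)])
  have S: "?S = {?A, ?B}" by blast
  have A: "?A \<in> independent_sets G" using independent_sets_subset[OF assms(3)] by blast
  have sym: "(x, y) \<in> parcs G \<Longrightarrow> (y, x) \<in> parcs G" for x y
    using pair_sym_arcs by (auto simp: symmetric_def dest: symD)
  have loop: "(x, x) \<notin> parcs G" for x using pair_no_loops by force
  have B: "?B \<in> independent_sets G \<longleftrightarrow> \<not> (\<exists>u\<in>I. (u, v) \<in> parcs G)"
    using assms(3,4) loop by (auto simp: independent_sets_def dest: sym)
  have AB: "?A \<noteq> ?B" by blast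
  have finI: "finite I"
    using assms(3) pair_finite_verts by (auto simp: independent_sets_def intro: finite_subset)
  have cB: "card ?B = Suc (card ?A)"
    using finI by (metis card.insert_remove)
  have ne: "set_pmf ?\<mu> \<inter> ?S \<noteq> {}"
    using A by (auto simp: set_pmf_hardcore[OF assms(1,2)])
  have m: "measure_pmf.prob ?\<mu> ?S = pmf ?\<mu> ?A + pmf ?\<mu> ?B"
    unfolding S by (subst measure_measure_pmf_finite) (use AB in auto)
  show ?thesis
  proof (rule pmf_eqI)
    fix J
    have l: "pmf (cond_pmf ?\<mu> ?S) J =
        (if J \<in> {?A, ?B} then pmf ?\<mu> J / (pmf ?\<mu> ?A + pmf ?\<mu> ?B) else 0)"
      unfolding pmf_cond[OF ne] m by (subst S) (rule refl)
    show "pmf (cond_pmf ?\<mu> ?S) J = pmf ?R J"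
    proof (cases "\<exists>u\<in>I. (u, v) \<in> parcs G")
      case True
      then have "?B \<notin> independent_sets G" using B by blast
      then have "pmf (cond_pmf ?\<mu> ?S) J = (if J = ?A then 1 else 0)"
        unfolding l using A Z assms(2) by (auto simp: pmf_hardcore[OF assms(1,2)])
      then show ?thesis using True by (auto simp: indicator_def)
    next
      case False
      then have B': "?B \<in> independent_sets G" using B by blast
      define w where "w = lam ^ card ?A / ?Z"
      have w: "w > 0" using Z assms(2) by (simp add: w_def)
      have pA: "pmf ?\<mu> ?A = w" using A by (simp add: pmf_hardcore[OF assms(1,2)] w_def)
      have pB: "pmf ?\<mu> ?B = lam * w"
        using B' cB by (simp add: pmf_hardcore[OF assms(1,2)] w_def)
      have qA: "w / (w + lam * w) = 1 - lam / (1 + lam)"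
        and qB: "lam * w / (w + lam * w) = lam / (1 + lam)"
      proof -
        have "w + lam * w \<noteq> 0" "1 + lam \<noteq> 0"
          using w assms(2) by (simp_all add: add_pos_pos less_imp_neq[symmetric])
        then show "w / (w + lam * w) = 1 - lam / (1 + lam)"
          and "lam * w / (w + lam * w) = lam / (1 + lam)"
          by (simp_all add: divide_simps) (simp_all add: algebra_simps)
      qed
      have r: "pmf ?R J = (if J = ?B then lam / (1 + lam) else 0) +
          (if J = ?A then 1 - lam / (1 + lam) else 0)"
      proof -
        define p where "p = lam / (1 + lam)"
        have p: "0 \<le> p" "p \<le> 1" using assms(2) by (simp_all add: p_def)
        show ?thesis
          using False p AB unfolding p_def[symmetric]
          by (auto simp: map_pmf_def pmf_bind indicator_def)
      qed
      consider "J = ?A" | "J = ?B" | "J \<noteq> ?A" "J \<noteq> ?B" by blast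
      then show ?thesis
      proof cases
        case 1
        then show ?thesis unfolding l r pA pB using AB pA qA by simp
      next
        case 2
        then show ?thesis unfolding l r pA pB using AB pB qB by simp
      next
        case 3
        then show ?thesis unfolding l r by simp
      qed
    qed
  qed
qed

end

theory Submission
  imports Defs
begin

text \<open>Write \<open>p\<close> for the occupation probability of a vertex \<open>u\<close>, and \<open>p\<^sub>1, p\<^sub>2, \<dots>\<close> for those of its
  neighbours when \<open>u\<close> and then the neighbours themselves are deleted one after the other.
  Then \<open>p / (1 - p) = lam (1 - p\<^sub>1) (1 - p\<^sub>2) \<dots>\<close>, and the total influence \<open>T\<close> of \<open>u\<close> on the other
  vertices satisfies \<open>T \<le> 1 + p\<^sub>1 T\<^sub>1 + p\<^sub>2 T\<^sub>2 + \<dots>\<close>. With the potential \<open>sqrt p\<close> this recursion is a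
  contraction below the critical fugacity, so that all total influences are at most \<open>32 / \<delta>\<close>, in
  every induced subgraph (spectral independence). The law of total variance over a uniformly
  random vertex then shows by induction on the number of vertices that the Poincare constant is of order
  \<open>n powr (32 / \<delta>)\<close>. This bounds the mixing time up to a factor \<open>ln (1 / \<mu> x)\<close>, which
  is linear in \<open>n\<close> unless \<open>lam\<close> is small; small \<open>lam\<close> is treated by a Lipschitz contraction
  (path coupling).\<close>

section \<open>Hardcore measures on induced subgraphs\<close>

text \<open>Fixing a spin leaves the hardcore model on an induced subgraph, so inductions over
  vertex sets replace boundary conditions, and degree bounds are inherited. The contraction holds
  for at most \<open>\<Delta> - 1\<close> neighbours. Every vertex met in the recursion satisfies
  this because its predecessor has been deleted; only the root may have \<open>\<Delta>\<close>
  neighbours. It costs one extra step, paid for by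
  \<open>\<Delta> * lam / (1 + lam) \<le> 15 / 2\<close>, which gives
  \<open>1 + 30 / \<delta> \<le> 32 / \<delta>\<close> with no dependence on
  \<open>\<Delta>\<close>. With \<open>\<eta> = 32 / \<delta>\<close>, the induction multiplies the
  Poincare constant at size \<open>k\<close> by \<open>(k - 1) / (k - \<eta>)\<close>. This makes
  sense only for \<open>k > \<eta>\<close>, so sets of at most \<open>m\<close> vertices,
  \<open>m\<close> about \<open>\<eta>\<close> squared, get a crude constant that is exponential in
  \<open>m\<close> but free of \<open>n\<close>. In the exponent \<open>2 + \<eta>\<close>, one
  \<open>n\<close> is the rate of picking a vertex and the other comes from the logarithm of the
  smallest probability. The factors \<open>(1 + lam) / lam\<close> would spoil uniformity as
  \<open>lam\<close> tends to 0; hence the second argument for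
  \<open>\<Delta> * lam \<le> 1 / 2\<close>.\<close>

locale hardcore_weights =
  fixes E :: "'v \<Rightarrow> 'v \<Rightarrow> bool" and lam :: real
  assumes E_sym: "E u v \<Longrightarrow> E v u" and E_irrefl: "\<not> E v v" and lam_pos: "lam > 0"
begin

definition indep :: "'v set \<Rightarrow> 'v set set" where
  "indep V = {I. I \<subseteq> V \<and> (\<forall>u\<in>I. \<forall>v\<in>I. \<not> E u v)}"

definition nbhd :: "'v \<Rightarrow> 'v set" where
  "nbhd v = insert v {u. E v u}"

text \<open>Kept unnormalised so that the recursion in a vertex is exact and linear
  (\<open>wsum_split\<close>); probabilities then appear as ratios of values of
  \<open>Z\<close>.\<close>

definition wsum :: "'v set \<Rightarrow> ('v set \<Rightarrow> real) \<Rightarrow> real" where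
  "wsum V f = (\<Sum>I\<in>indep V. lam ^ card I * f I)"

abbreviation Z :: "'v set \<Rightarrow> real" where
  "Z V \<equiv> wsum V (\<lambda>_. 1)"

definition expct :: "'v set \<Rightarrow> ('v set \<Rightarrow> real) \<Rightarrow> real" where
  "expct V f = wsum V f / Z V"

definition cov :: "'v set \<Rightarrow> ('v set \<Rightarrow> real) \<Rightarrow> ('v set \<Rightarrow> real) \<Rightarrow> real" where
  "cov V f g = expct V (\<lambda>I. f I * g I) - expct V f * expct V g"

definition spin :: "'v \<Rightarrow> 'v set \<Rightarrow> real" where
  "spin v I = of_bool (v \<in> I)"

definition occ :: "'v set \<Rightarrow> 'v \<Rightarrow> real" where
  "occ V v = expct V (spin v)"

text \<open>The conditional expectation given that \<open>v\<close> is occupied minus the one given that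
  it is not; deleting \<open>nbhd v\<close> resp. \<open>v\<close> from the graph realises the conditioning.\<close>

definition jump :: "'v set \<Rightarrow> 'v \<Rightarrow> ('v set \<Rightarrow> real) \<Rightarrow> real" where
  "jump V v f = expct (V - nbhd v) (\<lambda>I. f (insert v I)) - expct (V - {v}) f"

text \<open>Times \<open>lam / ((1 + lam) * Z V)\<close>, this is the expected conditional variance
  of \<open>f\<close> given all spins but the one at \<open>w\<close>: the pair \<open>A\<close>,
  \<open>insert w A\<close> has weight \<open>(1 + lam) * lam ^ card A\<close>, and the spin on it
  is Bernoulli with parameter \<open>lam / (1 + lam)\<close>. So \<open>energy\<close> is a multiple
  of the Dirichlet form.\<close>

definition grad :: "'v set \<Rightarrow> 'v \<Rightarrow> ('v set \<Rightarrow> real) \<Rightarrow> real" where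
  "grad V w f = wsum (V - nbhd w) (\<lambda>A. (f (insert w A) - f A)\<^sup>2)"

definition energy :: "'v set \<Rightarrow> ('v set \<Rightarrow> real) \<Rightarrow> real" where
  "energy V f = (\<Sum>w\<in>V. grad V w f)"

lemma finite_indep: "finite V \<Longrightarrow> finite (indep V)"
  by (rule finite_subset[of _ "Pow V"]) (auto simp: indep_def)

lemma empty_in_indep: "{} \<in> indep V"
  by (simp add: indep_def)

lemma indep_mono: "V \<subseteq> V' \<Longrightarrow> indep V \<subseteq> indep V'"
  by (auto simp: indep_def)

lemma nbhd_self: "v \<in> nbhd v"
  by (simp add: nbhd_def)

lemma nbhd_sym: "u \<in> nbhd v \<longleftrightarrow> v \<in> nbhd u"
  using E_sym by (auto simp: nbhd_def)

lemma insert_in_indep_iff: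
  assumes "v \<in> V" "v \<notin> A"
  shows "insert v A \<in> indep V \<longleftrightarrow> A \<in> indep (V - nbhd v)"
  using assms E_sym E_irrefl by (auto simp: indep_def nbhd_def)

lemma indep_split:
  assumes "v \<in> V"
  shows "indep V = indep (V - {v}) \<union> insert v ` indep (V - nbhd v)"
proof (intro equalityI subsetI)
  fix I assume I: "I \<in> indep V"
  show "I \<in> indep (V - {v}) \<union> insert v ` indep (V - nbhd v)"
  proof (cases "v \<in> I")
    case True
    then have "I = insert v (I - {v})" by blast
    moreover have "I - {v} \<in> indep (V - nbhd v)"
      using I True insert_in_indep_iff[OF assms, of "I - {v}"] by (simp add: insert_absorb)
    ultimately show ?thesis by blast
  next
    case False
    with I show ?thesis by (auto simp: indep_def)
  qed
next
  fix I assume "I \<in> indep (V - {v}) \<union> insert v ` indep (V - nbhd v)"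
  then show "I \<in> indep V"
  proof
    assume "I \<in> indep (V - {v})"
    then show ?thesis using indep_mono[of "V - {v}" V] by blast
  next
    assume "I \<in> insert v ` indep (V - nbhd v)"
    then obtain A where A: "I = insert v A" "A \<in> indep (V - nbhd v)" by blast
    then have "v \<notin> A" by (auto simp: indep_def nbhd_def)
    with A show ?thesis using insert_in_indep_iff[OF assms] by blast
  qed
qed

lemma wsum_split:
  assumes "finite V" "v \<in> V"
  shows "wsum V f = wsum (V - {v}) f + lam * wsum (V - nbhd v) (\<lambda>I. f (insert v I))"
proof -
  have v: "v \<notin> A" if "A \<in> indep (V - nbhd v)" for A
    using that by (auto simp: indep_def nbhd_def)
  have inj: "inj_on (insert v) (indep (V - nbhd v))"
    by (intro inj_onI) (metis v insert_ident)
  have "wsum V f = wsum (V - {v}) f + (\<Sum>I\<in>insert v ` indep (V - nbhd v). lam ^ card I * f I)"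
    unfolding wsum_def indep_split[OF assms(2)]
    by (rule sum.union_disjoint) (use assms finite_indep in \<open>auto simp: indep_def\<close>)
  also have "(\<Sum>I\<in>insert v ` indep (V - nbhd v). lam ^ card I * f I) =
      (\<Sum>A\<in>indep (V - nbhd v). lam ^ card (insert v A) * f (insert v A))"
    by (subst sum.reindex[OF inj]) simp
  also have "\<dots> = (\<Sum>A\<in>indep (V - nbhd v). lam * (lam ^ card A * f (insert v A)))"
  proof (rule sum.cong[OF refl])
    fix A assume A: "A \<in> indep (V - nbhd v)"
    then have "finite A" using assms(1) by (auto simp: indep_def intro: finite_subset)
    then show "lam ^ card (insert v A) * f (insert v A) = lam * (lam ^ card A * f (insert v A))"
      using v[OF A] by simp
  qed
  finally show ?thesis by (simp add: wsum_def sum_distrib_left)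
qed

lemma wsum_cong: "(\<And>I. I \<in> indep V \<Longrightarrow> f I = g I) \<Longrightarrow> wsum V f = wsum V g"
  by (simp add: wsum_def)

lemma wsum_mono: "(\<And>I. I \<in> indep V \<Longrightarrow> f I \<le> g I) \<Longrightarrow> wsum V f \<le> wsum V g"
  using lam_pos by (auto simp: wsum_def intro!: sum_mono mult_left_mono)

lemma wsum_nonneg: "(\<And>I. I \<in> indep V \<Longrightarrow> 0 \<le> f I) \<Longrightarrow> 0 \<le> wsum V f"
  using lam_pos by (auto simp: wsum_def intro!: sum_nonneg)

lemma wsum_add: "wsum V (\<lambda>I. f I + g I) = wsum V f + wsum V g"
  by (simp add: wsum_def algebra_simps sum.distrib)

lemma wsum_diff: "wsum V (\<lambda>I. f I - g I) = wsum V f - wsum V g"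
  by (simp add: wsum_def algebra_simps sum_subtractf)

lemma wsum_cmult: "wsum V (\<lambda>I. c * f I) = c * wsum V f"
  by (simp add: wsum_def sum_distrib_left algebra_simps)

lemma wsum_sum: "wsum V (\<lambda>I. \<Sum>x\<in>S. f x I) = (\<Sum>x\<in>S. wsum V (f x))"
  unfolding wsum_def sum_distrib_left by (rule sum.swap)

lemma wsum_const: "wsum V (\<lambda>I. c) = c * Z V"
  using wsum_cmult[of V c "\<lambda>_. 1"] by simp

lemma wsum_zero: "wsum V (\<lambda>I. 0) = 0"
  by (simp add: wsum_def)

lemma Z_pos: "finite V \<Longrightarrow> Z V > 0"
  unfolding wsum_def using lam_pos finite_indep[of V] empty_in_indep[of V]
  by (intro sum_pos) auto

lemma expct_cong: "(\<And>I. I \<in> indep V \<Longrightarrow> f I = g I) \<Longrightarrow> expct V f = expct V g"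
  unfolding expct_def using wsum_cong[of V f g] by simp

lemma expct_mono:
  "finite V \<Longrightarrow> (\<And>I. I \<in> indep V \<Longrightarrow> f I \<le> g I) \<Longrightarrow> expct V f \<le> expct V g"
  unfolding expct_def using wsum_mono[of V f g] Z_pos[of V] by (simp add: divide_right_mono)

lemma expct_add: "expct V (\<lambda>I. f I + g I) = expct V f + expct V g"
  by (simp add: expct_def wsum_add add_divide_distrib)

lemma expct_diff: "expct V (\<lambda>I. f I - g I) = expct V f - expct V g"
  by (simp add: expct_def wsum_diff diff_divide_distrib)

lemma expct_cmult: "expct V (\<lambda>I. c * f I) = c * expct V f"
  by (simp add: expct_def wsum_cmult)

lemma expct_sum: "expct V (\<lambda>I. \<Sum>x\<in>S. f x I) = (\<Sum>x\<in>S. expct V (f x))"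
  by (simp add: expct_def wsum_sum sum_divide_distrib)

lemma expct_const: "finite V \<Longrightarrow> expct V (\<lambda>I. c) = c"
  using Z_pos[of V] unfolding expct_def wsum_const[of V c] by simp

lemma expct_nonneg: "finite V \<Longrightarrow> (\<And>I. I \<in> indep V \<Longrightarrow> 0 \<le> f I) \<Longrightarrow> 0 \<le> expct V f"
  using expct_mono[of V "\<lambda>_. 0" f] by (simp add: expct_const)

lemma cov_commute: "cov V f g = cov V g f"
  by (simp add: cov_def mult.commute)

lemma cov_diff_left: "cov V (\<lambda>I. f I - g I) h = cov V f h - cov V g h"
  by (simp add: cov_def expct_diff left_diff_distrib)

lemma cov_diff_right: "cov V h (\<lambda>I. f I - g I) = cov V h f - cov V h g"
  by (simp add: cov_def expct_diff right_diff_distrib)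

lemma cov_cmult_left: "cov V (\<lambda>I. c * f I) g = c * cov V f g"
  by (simp add: cov_def expct_cmult mult.assoc right_diff_distrib)

lemma cov_cmult_right: "cov V g (\<lambda>I. c * f I) = c * cov V g f"
  using cov_cmult_left[of V c f g] by (simp add: cov_commute)

lemma cov_sum_left: "cov V (\<lambda>I. \<Sum>x\<in>S. f x I) g = (\<Sum>x\<in>S. cov V (f x) g)"
  by (simp add: cov_def expct_sum sum_distrib_right sum_subtractf)

lemma cov_sum_right: "cov V g (\<lambda>I. \<Sum>x\<in>S. f x I) = (\<Sum>x\<in>S. cov V g (f x))"
  using cov_sum_left[of V f S g] by (simp add: cov_commute)

lemma cov_self_centered:
  assumes "finite V"
  shows "cov V f f = expct V (\<lambda>I. (f I - c)\<^sup>2) - (expct V f - c)\<^sup>2"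
proof -
  have "expct V (\<lambda>I. (f I - c)\<^sup>2) = expct V (\<lambda>I. (f I * f I - (2 * c) * f I) + c\<^sup>2)"
    by (intro expct_cong) (simp add: power2_eq_square algebra_simps)
  also have "\<dots> = expct V (\<lambda>I. f I * f I) - 2 * c * expct V f + c\<^sup>2"
    by (simp only: expct_add expct_diff expct_cmult expct_const[OF assms])
  finally show ?thesis by (simp add: cov_def power2_eq_square algebra_simps)
qed

lemma cov_self_nonneg: "finite V \<Longrightarrow> 0 \<le> cov V f f"
  using cov_self_centered[of V f "expct V f"] expct_nonneg[of V "\<lambda>I. (f I - expct V f)\<^sup>2"]
  by simp

lemma cov_self_le: "finite V \<Longrightarrow> cov V f f \<le> expct V (\<lambda>I. (f I - c)\<^sup>2)"
  using cov_self_centered[of V f c] by simp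

section \<open>Conditioning on the spin of one vertex\<close>

lemma occ_eq:
  assumes "finite V" "v \<in> V"
  shows "occ V v = lam * Z (V - nbhd v) / Z V"
proof -
  have "wsum (V - {v}) (spin v) = wsum (V - {v}) (\<lambda>_. 0)"
    by (rule wsum_cong) (auto simp: spin_def indep_def)
  then have "wsum (V - {v}) (spin v) = 0" by (simp add: wsum_zero)
  moreover have "(\<lambda>I. spin v (insert v I)) = (\<lambda>_. 1)" by (simp add: spin_def)
  ultimately show ?thesis
    unfolding occ_def expct_def wsum_split[OF assms, of "spin v"] by simp
qed

lemma one_minus_occ_eq:
  assumes "finite V" "v \<in> V"
  shows "1 - occ V v = Z (V - {v}) / Z V"
  using wsum_split[OF assms, of "\<lambda>_. 1"] Z_pos[OF assms(1)]
  by (simp add: occ_eq[OF assms] field_simps)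

lemma occ_pos: "finite V \<Longrightarrow> v \<in> V \<Longrightarrow> 0 < occ V v"
  using Z_pos[of V] Z_pos[of "V - nbhd v"] lam_pos by (simp add: occ_eq)

lemma occ_less_1: "finite V \<Longrightarrow> v \<in> V \<Longrightarrow> occ V v < 1"
  using Z_pos[of V] Z_pos[of "V - {v}"] one_minus_occ_eq[of V v]
  by (metis diff_gt_0_iff_gt divide_pos_pos finite_Diff)

lemma occ_outside: "v \<notin> V \<Longrightarrow> occ V v = 0"
proof -
  assume "v \<notin> V"
  then have "wsum V (spin v) = wsum V (\<lambda>_. 0)"
    by (intro wsum_cong) (auto simp: spin_def indep_def)
  then show ?thesis by (simp add: occ_def expct_def wsum_zero)
qed

lemma expct_split:
  assumes "finite V" "v \<in> V"
  shows "expct V f = occ V v * expct (V - nbhd v) (\<lambda>I. f (insert v I))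
    + (1 - occ V v) * expct (V - {v}) f"
proof -
  have "occ V v * expct (V - nbhd v) (\<lambda>I. f (insert v I)) =
      lam * wsum (V - nbhd v) (\<lambda>I. f (insert v I)) / Z V"
    using Z_pos[of "V - nbhd v"] assms(1) by (simp add: occ_eq[OF assms] expct_def)
  moreover have "(1 - occ V v) * expct (V - {v}) f = wsum (V - {v}) f / Z V"
    using Z_pos[of "V - {v}"] assms(1) by (simp add: one_minus_occ_eq[OF assms] expct_def)
  ultimately show ?thesis
    unfolding expct_def[of V] wsum_split[OF assms, of f] by (simp add: add_divide_distrib)
qed

text \<open>\<open>V - {v}\<close> carries the law conditioned on \<open>v\<close> being empty, so
  deleting \<open>v\<close> costs the probability of the other event times the jump. Iterated over
  the neighbours of a vertex, this yields the influence recursion.\<close>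

lemma expct_diff_delete:
  assumes "finite V" "v \<in> V"
  shows "expct V f - expct (V - {v}) f = occ V v * jump V v f"
  unfolding expct_split[OF assms, of f] jump_def by (simp add: algebra_simps)

lemma cov_spin:
  assumes "finite V" "v \<in> V"
  shows "cov V (spin v) f = occ V v * (1 - occ V v) * jump V v f"
proof -
  have "expct (V - {v}) (\<lambda>I. spin v I * f I) = expct (V - {v}) (\<lambda>I. 0)"
    by (rule expct_cong) (auto simp: spin_def indep_def)
  then have "expct V (\<lambda>I. spin v I * f I) = occ V v * expct (V - nbhd v) (\<lambda>I. f (insert v I))"
    using assms by (subst expct_split[OF assms]) (simp add: spin_def expct_const)
  then show ?thesis
    unfolding cov_def occ_def[symmetric] expct_split[OF assms, of f] jump_def
    by (simp add: algebra_simps)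
qed

text \<open>The last term is the variance of the conditional expectation given the spin at
  \<open>v\<close>, a two-point variable with gap \<open>jump V v f\<close>.\<close>

lemma total_variance:
  assumes "finite V" "v \<in> V"
  shows "cov V f f = occ V v * cov (V - nbhd v) (\<lambda>I. f (insert v I)) (\<lambda>I. f (insert v I))
    + (1 - occ V v) * cov (V - {v}) f f + occ V v * (1 - occ V v) * (jump V v f)\<^sup>2"
  unfolding cov_def jump_def expct_split[OF assms, of f] expct_split[OF assms, of "\<lambda>I. f I * f I"]
  by (simp add: power2_eq_square algebra_simps)

section \<open>The Dirichlet form under conditioning\<close>

lemma grad_nonneg: "0 \<le> grad V w f"
  unfolding grad_def by (rule wsum_nonneg) simp

lemma energy_nonneg: "0 \<le> energy V f"
  unfolding energy_def by (simp add: sum_nonneg grad_nonneg)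

lemma grad_split:
  assumes "finite V" "v \<in> V" "w \<in> V" "w \<noteq> v"
  shows "grad V w f = grad (V - {v}) w f
    + (if w \<in> nbhd v then 0 else lam * grad (V - nbhd v) w (\<lambda>I. f (insert v I)))"
proof (cases "w \<in> nbhd v")
  case True
  then have "V - nbhd w = V - {v} - nbhd w" using nbhd_sym by blast
  with True show ?thesis by (simp add: grad_def)
next
  case False
  then have v: "v \<in> V - nbhd w" using nbhd_sym assms(2) by blast
  have "V - nbhd w - {v} = V - {v} - nbhd w" "V - nbhd w - nbhd v = V - nbhd v - nbhd w"
    by auto
  with False show ?thesis
    unfolding grad_def using assms(1)
    by (subst wsum_split[OF _ v]) (simp_all add: insert_commute)
qed

text \<open>The pairs \<open>A\<close>, \<open>insert w A\<close> with \<open>w \<noteq> v\<close>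
  are sorted by whether \<open>v\<close> is occupied; only the term at \<open>v\<close> is lost. The
  weights 1 and \<open>lam\<close> are, after division by \<open>Z V\<close>, those that
  \<open>total_variance\<close> produces, so the induction for the Poincare inequality loses nothing
  here.\<close>

lemma energy_split:
  assumes "finite V" "v \<in> V"
  shows "energy (V - {v}) f + lam * energy (V - nbhd v) (\<lambda>I. f (insert v I))
    = energy V f - grad V v f"
proof -
  let ?g = "\<lambda>w. grad (V - nbhd v) w (\<lambda>I. f (insert v I))"
  have "energy V f - grad V v f = (\<Sum>w\<in>V - {v}. grad V w f)"
    unfolding energy_def by (subst sum.remove[OF assms]) simp
  also have "\<dots> = (\<Sum>w\<in>V - {v}. grad (V - {v}) w f + (if w \<in> nbhd v then 0 else lam * ?g w))"
    by (rule sum.cong[OF refl]) (use grad_split[OF assms] in auto)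
  also have "\<dots> = energy (V - {v}) f + (\<Sum>w\<in>V - {v}. if w \<in> nbhd v then 0 else lam * ?g w)"
    by (simp add: sum.distrib energy_def)
  also have "(\<Sum>w\<in>V - {v}. if w \<in> nbhd v then 0 else lam * ?g w) = (\<Sum>w\<in>V - nbhd v. lam * ?g w)"
    by (rule sum.mono_neutral_cong_right) (use assms nbhd_self[of v] in auto)
  finally show ?thesis by (simp add: energy_def sum_distrib_left)
qed

lemma Z_le:
  assumes "finite V"
  shows "Z V \<le> (1 + lam) ^ card V"
proof -
  have "Z V \<le> (\<Sum>I\<in>Pow V. lam ^ card I * 1)"
    unfolding wsum_def using lam_pos assms by (intro sum_mono2) (auto simp: indep_def)
  also have "\<dots> = (1 + lam) ^ card V"
    using assms
  proof (induction V)
    case empty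
    then show ?case by simp
  next
    case (insert x F)
    have "(\<Sum>I\<in>Pow (insert x F). lam ^ card I * 1) =
      (\<Sum>I\<in>Pow F. lam ^ card I) + (\<Sum>I\<in>insert x ` Pow F. lam ^ card I)"
      using insert.hyps unfolding Pow_insert
      by (subst sum.union_disjoint) auto
    also have "(\<Sum>I\<in>insert x ` Pow F. lam ^ card I) = (\<Sum>I\<in>Pow F. lam ^ card (insert x I))"
      using insert.hyps by (subst sum.reindex) (auto simp: inj_on_def)
    also have "\<dots> = (\<Sum>I\<in>Pow F. lam * lam ^ card I)"
    proof (rule sum.cong[OF refl])
      fix I assume "I \<in> Pow F"
      then have "finite I" "x \<notin> I" using insert.hyps by (auto intro: finite_subset)
      then show "lam ^ card (insert x I) = lam * lam ^ card I" by simp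
    qed
    finally show ?case
      using insert by (simp add: sum_distrib_left[symmetric] algebra_simps)
  qed
  finally show ?thesis .
qed

end

section \<open>Decay of influences below the critical fugacity\<close>

lemma power_times_affine_le_1:
  fixes a :: real
  assumes "0 \<le> a"
  shows "a ^ d * (real d + 1 - real d * a) \<le> 1"
proof (cases "a = 0")
  case True
  then show ?thesis by (cases d) auto
next
  case False
  with assms have a: "a > 0" by simp
  \<comment> \<open>Bernoulli's inequality at \<open>1 / a\<close> is tight at \<open>a = 1\<close>,
    the maximiser of the left-hand side.\<close>
  have "1 + real (Suc d) * (1 / a - 1) \<le> (1 + (1 / a - 1)) ^ Suc d"
    using a by (intro Bernoulli_inequality) (simp add: field_simps)
  then have "(real d + 1 - real d * a) / a \<le> 1 / a ^ Suc d"
    using a by (simp add: field_simps power_divide)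
  then have "a ^ Suc d * ((real d + 1 - real d * a) / a) \<le> a ^ Suc d * (1 / a ^ Suc d)"
    using a by (intro mult_left_mono) auto
  then show ?thesis using a by simp
qed

text \<open>At the maximiser \<open>1 - c\<close> is split into \<open>d + 1\<close> equal parts
  \<open>q\<close>, one for \<open>x - c\<close> and \<open>d\<close> for \<open>1 - x\<close>.
  Measuring \<open>1 - x\<close> in units of its optimal value \<open>d * q\<close> moves the
  maximum to \<open>a = 1\<close>.\<close>

lemma power_times_linear_max:
  fixes x c :: real
  assumes "x \<le> 1" "c < 1" "d > 0"
  shows "(1 - x) ^ d * (x - c) \<le> real d ^ d * ((1 - c) / (real d + 1)) ^ Suc d"
proof -
  define q where "q = (1 - c) / (real d + 1)"
  have q: "q > 0" using assms by (simp add: q_def)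
  define a where "a = (1 - x) / (real d * q)"
  have a: "a \<ge> 0" using assms q by (simp add: a_def)
  have x: "1 - x = a * (real d * q)" using assms q by (simp add: a_def)
  have "q * (real d + 1) = 1 - c" using assms by (simp add: q_def add_eq_0_iff_both_eq_0)
  then have "x - c = q * (real d + 1 - real d * a)"
    using x by (simp add: algebra_simps)
  then have "(1 - x) ^ d * (x - c) = real d ^ d * q ^ Suc d * (a ^ d * (real d + 1 - real d * a))"
    unfolding x by (simp add: power_mult_distrib mult_ac)
  also have "\<dots> \<le> real d ^ d * q ^ Suc d * 1"
    using power_times_affine_le_1[OF a] q by (intro mult_left_mono) auto
  finally show ?thesis by (simp add: q_def)
qed

text \<open>With \<open>y = lam * (1 - x) ^ d\<close> the claim says that
  \<open>y / (1 + y) * (d^2 * x)\<close> is at most \<open>1 - \<delta> / 2\<close>: the squared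
  contraction factor when all \<open>d\<close> neighbours have occupation probability
  \<open>x\<close>. With 0 in place of \<open>\<delta>\<close> in the conclusion, the maximum over
  \<open>x\<close> of the left side is exactly \<open>lam / hardcore_critical (Suc d)\<close>; this
  is where the critical fugacity enters.\<close>

lemma subcritical_recursion_bound:
  fixes x \<delta> lam :: real
  assumes d: "d \<ge> 2" and x: "x \<le> 1" and \<delta>: "0 < \<delta>" "\<delta> < 1"
    and lam: "0 < lam" "lam \<le> (1 - \<delta>) * hardcore_critical (Suc d)"
  shows "lam * (1 - x) ^ d * (real d ^ 2 * x - (1 - \<delta> / 2)) \<le> 1 - \<delta> / 2"
proof -
  define D where "D = real d"
  have D: "D \<ge> 2" using d by (simp add: D_def)
  define \<beta> where "\<beta> = 1 - \<delta> / 2"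
  define c where "c = \<beta> / D\<^sup>2"
  \<comment> \<open>\<open>c\<close> is the zero of the linear factor, and \<open>\<kappa>\<close>
    is the ratio of \<open>1 - c\<close> to its value for \<open>\<beta> = 1\<close>.\<close>
  define \<kappa> where "\<kappa> = 1 + \<delta> / (2 * (D\<^sup>2 - 1))"
  have D2: "D\<^sup>2 \<ge> 4" using D power_mono[of 2 D 2] by simp
  have \<beta>: "0 < \<beta>" "\<beta> < 1" using \<delta> by (simp_all add: \<beta>_def)
  have "0 < D\<^sup>2" "\<beta> < D\<^sup>2" using \<beta> D2 by linarith+
  then have c: "c < 1" unfolding c_def by (subst pos_divide_less_eq) auto
  have \<kappa>: "\<kappa> \<ge> 1" using \<delta> D2 by (simp add: \<kappa>_def)
  have c\<kappa>: "1 - c = \<kappa> * ((D - 1) * (D + 1) / D\<^sup>2)"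
  proof -
    have "\<kappa> * (D\<^sup>2 - 1) = D\<^sup>2 - \<beta>"
      using D2 by (simp add: \<kappa>_def \<beta>_def field_simps)
    moreover have "(D - 1) * (D + 1) = D\<^sup>2 - 1" by (simp add: power2_eq_square algebra_simps)
    ultimately have "\<kappa> * ((D - 1) * (D + 1) / D\<^sup>2) = (D\<^sup>2 - \<beta>) / D\<^sup>2" by simp
    also have "\<dots> = 1 - c" using D by (simp add: c_def diff_divide_distrib)
    finally show ?thesis by simp
  qed
  have cr: "hardcore_critical (Suc d) = D ^ d / (D - 1) ^ Suc d"
    by (simp add: hardcore_critical_def D_def)
  have cr_pos: "hardcore_critical (Suc d) > 0" unfolding cr using D by simp
  have "(1 - x) ^ d * (D\<^sup>2 * x - \<beta>) = D\<^sup>2 * ((1 - x) ^ d * (x - c))"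
    using D by (simp add: c_def field_simps)
  also have "\<dots> \<le> D\<^sup>2 * (D ^ d * ((1 - c) / (D + 1)) ^ Suc d)"
    unfolding D_def using x c d by (intro mult_left_mono power_times_linear_max) auto
  also have "(1 - c) / (D + 1) = \<kappa> * (D - 1) / D\<^sup>2"
    unfolding c\<kappa> using D by simp
  also have "D\<^sup>2 * (D ^ d * (\<kappa> * (D - 1) / D\<^sup>2) ^ Suc d) = \<kappa> ^ Suc d * ((D - 1) ^ Suc d / D ^ d)"
  proof -
    have "(D\<^sup>2) ^ Suc d = D\<^sup>2 * (D ^ d * D ^ d)"
      by (simp add: power_mult_distrib power2_eq_square)
    then have "(\<kappa> * (D - 1) / D\<^sup>2) ^ Suc d = \<kappa> ^ Suc d * (D - 1) ^ Suc d / (D\<^sup>2 * (D ^ d * D ^ d))"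
      by (simp only: power_divide power_mult_distrib)
    then show ?thesis using D by (simp del: power_Suc)
  qed
  also have "(D - 1) ^ Suc d / D ^ d = 1 / hardcore_critical (Suc d)"
    unfolding cr by simp
  finally have *: "(1 - x) ^ d * (D\<^sup>2 * x - \<beta>) \<le> \<kappa> ^ Suc d / hardcore_critical (Suc d)" by simp
  have "lam * ((1 - x) ^ d * (D\<^sup>2 * x - \<beta>)) \<le> lam * (\<kappa> ^ Suc d / hardcore_critical (Suc d))"
    using lam * by (intro mult_left_mono) auto
  also have "\<dots> = lam / hardcore_critical (Suc d) * \<kappa> ^ Suc d" by simp
  also have "\<dots> \<le> (1 - \<delta>) * \<kappa> ^ Suc d"
    using lam cr_pos \<kappa> by (intro mult_right_mono) (auto simp: field_simps)
  \<comment> \<open>The margin is shared out by \<open>1 - \<delta> \<le> \<beta> * \<beta>\<close>: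
    one \<open>\<beta>\<close> absorbs \<open>\<kappa> ^ Suc d\<close>, by Bernoulli's inequality at
    \<open>1 / \<kappa>\<close>, the other is the bound. The absorption needs
    \<open>D + 1 \<le> D^2 - 1\<close>, that is \<open>d \<ge> 2\<close>.\<close>
  also have "\<dots> \<le> \<beta>"
  proof -
    have \<kappa>inv: "1 / \<kappa> - 1 \<ge> - (\<delta> / (2 * (D\<^sup>2 - 1)))"
    proof -
      define y where "y = \<delta> / (2 * (D\<^sup>2 - 1))"
      have y: "y \<ge> 0" using \<delta> D2 by (simp add: y_def)
      then have "1 / (1 + y) - 1 \<ge> - y" by (simp add: field_simps)
      then show ?thesis by (simp add: \<kappa>_def y_def)
    qed
    have "real (Suc d) * (\<delta> / (2 * (D\<^sup>2 - 1))) \<le> \<delta> / 2"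
    proof -
      have "(D + 1) * 1 \<le> (D + 1) * (D - 1)" using D by (intro mult_left_mono) auto
      then have "D + 1 \<le> D\<^sup>2 - 1" by (simp add: power2_eq_square algebra_simps)
      then have "(D + 1) / (D\<^sup>2 - 1) \<le> 1" using D2 by simp
      then have "\<delta> / 2 * ((D + 1) / (D\<^sup>2 - 1)) \<le> \<delta> / 2 * 1"
        using \<delta> by (intro mult_left_mono) auto
      then show ?thesis by (simp add: D_def field_simps)
    qed
    moreover have "real (Suc d) * (1 / \<kappa> - 1) \<ge> real (Suc d) * (- (\<delta> / (2 * (D\<^sup>2 - 1))))"
      by (intro mult_left_mono \<kappa>inv) simp
    ultimately have "\<beta> \<le> 1 + real (Suc d) * (1 / \<kappa> - 1)" by (simp add: \<beta>_def)
    also have "\<dots> \<le> (1 + (1 / \<kappa> - 1)) ^ Suc d"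
      using \<kappa> by (intro Bernoulli_inequality) (simp add: field_simps)
    finally have "\<beta> \<le> 1 / \<kappa> ^ Suc d" by (simp add: power_divide)
    then have b: "\<beta> * \<kappa> ^ Suc d \<le> 1" using \<kappa> by (simp add: field_simps)
    have "1 - \<delta> \<le> \<beta> * \<beta>" using \<delta> by (simp add: \<beta>_def algebra_simps)
    then have "(1 - \<delta>) * \<kappa> ^ Suc d \<le> (\<beta> * \<beta>) * \<kappa> ^ Suc d"
      using \<kappa> by (intro mult_right_mono) auto
    also have "\<dots> = \<beta> * (\<beta> * \<kappa> ^ Suc d)" by simp
    also have "\<dots> \<le> \<beta> * 1" using b \<beta> by (intro mult_left_mono) auto
    finally show ?thesis by simp
  qed
  finally show ?thesis by (simp add: D_def \<beta>_def mult.assoc)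
qed

text \<open>The inequality of arithmetic and geometric means for \<open>d\<close> factors; missing
  neighbours are padded by factors 1, as if their \<open>p\<close> were 0.\<close>

lemma prod_le_mean_power:
  fixes p :: "nat \<Rightarrow> real"
  assumes "j \<le> d" "d > 0" "\<And>i. i < j \<Longrightarrow> p i \<le> 1"
  shows "(\<Prod>i<j. 1 - p i) \<le> (1 - (\<Sum>i<j. p i) / real d) ^ d"
proof -
  define q where "q i = (if i < j then 1 - p i else 1)" for i
  have q: "q i \<ge> 0" for i using assms(3) by (simp add: q_def)
  have s: "{..<d} \<inter> {..<j} = {..<j}" using assms(1) by auto
  have P: "(\<Prod>i<d. q i) = (\<Prod>i<j. 1 - p i)"
    using prod.inter_restrict[of "{..<d}" "\<lambda>i. 1 - p i" "{..<j}"] by (simp add: s q_def)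
  have "(\<Sum>i<d. q i) = (\<Sum>i<d. 1 - (if i \<in> {..<j} then p i else 0))"
    by (rule sum.cong) (auto simp: q_def)
  also have "\<dots> = real d - (\<Sum>i<j. p i)"
    using sum.inter_restrict[of "{..<d}" p "{..<j}"] by (simp add: sum_subtractf s)
  finally have S: "(\<Sum>i<d. q i) = real d - (\<Sum>i<j. p i)" .
  have pos: "(\<Prod>i<d. q i) \<ge> 0" using q by (simp add: prod_nonneg)
  have "(\<Prod>i<d. q i) powr (1 / real d) \<le> (\<Sum>i<d. q i / real d)"
    using arith_geom_mean[of "{..<d}" q] q assms(2) by (simp add: lessThan_empty_iff)
  also have "\<dots> = 1 - (\<Sum>i<j. p i) / real d"
    unfolding sum_divide_distrib[symmetric] S using assms(2) by (simp add: diff_divide_distrib)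
  finally have "((\<Prod>i<d. q i) powr (1 / real d)) ^ d \<le> (1 - (\<Sum>i<j. p i) / real d) ^ d"
    by (rule power_mono) simp
  moreover have "((\<Prod>i<d. q i) powr (1 / real d)) ^ d = (\<Prod>i<d. q i)"
  proof (cases "(\<Prod>i<d. q i) = 0")
    case True
    show ?thesis unfolding True using assms(2) by simp
  next
    case False
    with pos show ?thesis using assms(2) by (simp add: powr_power)
  qed
  ultimately show ?thesis by (simp add: P)
qed

lemma divide_one_plus_mono: "0 \<le> a \<Longrightarrow> a \<le> b \<Longrightarrow> a / (1 + a) \<le> b / (1 + b)" for a b :: real
  by (simp add: field_simps)

text \<open>Cauchy-Schwarz for the sum of roots and \<open>prod_le_mean_power\<close> for the
  product both replace the \<open>p i\<close> by their mean \<open>x\<close> over \<open>d\<close>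
  slots, so the symmetric case is the worst one.\<close>

lemma subcritical_contraction:
  fixes p :: "nat \<Rightarrow> real" and \<delta> lam :: real
  assumes d: "d \<ge> 2" and j: "j \<le> d" and p: "\<And>i. i < j \<Longrightarrow> 0 \<le> p i \<and> p i \<le> 1"
    and \<delta>: "0 < \<delta>" "\<delta> < 1"
    and lam: "0 < lam" "lam \<le> (1 - \<delta>) * hardcore_critical (Suc d)"
    and w: "w = lam * (\<Prod>i<j. 1 - p i)"
  shows "sqrt (w / (1 + w)) * (\<Sum>i<j. sqrt (p i)) \<le> 1 - \<delta> / 4"
proof -
  define x where "x = (\<Sum>i<j. p i) / real d"
  define y where "y = lam * (1 - x) ^ d"
  have "(\<Sum>i<j. p i) \<le> real j" using sum_mono[of "{..<j}" p "\<lambda>_. 1"] p by simp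
  then have x1: "x \<le> 1" using d j by (simp add: x_def)
  have y: "y \<ge> 0" using lam x1 by (simp add: y_def)
  have w0: "w \<ge> 0" unfolding w using lam p by (intro mult_nonneg_nonneg prod_nonneg) auto
  have "w \<le> y"
    unfolding w y_def x_def using d j p lam by (intro mult_left_mono prod_le_mean_power) auto
  then have wy: "w / (1 + w) \<le> y / (1 + y)" by (rule divide_one_plus_mono[OF w0])
  have "(\<Sum>i<j. sqrt (p i))\<^sup>2 \<le> (\<Sum>i<j. (sqrt (p i))\<^sup>2) * real j"
    using sum_squared_le_sum_of_squares[of "\<lambda>i. sqrt (p i)" "{..<j}"] by simp
  also have "\<dots> = (\<Sum>i<j. p i) * real j" using p by simp
  also have "\<dots> \<le> (\<Sum>i<j. p i) * real d" using j p by (intro mult_left_mono sum_nonneg) auto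
  also have "\<dots> = real d ^ 2 * x" using d by (simp add: x_def power2_eq_square)
  finally have S: "(\<Sum>i<j. sqrt (p i))\<^sup>2 \<le> real d ^ 2 * x" .
  have "(sqrt (w / (1 + w)) * (\<Sum>i<j. sqrt (p i)))\<^sup>2 = w / (1 + w) * (\<Sum>i<j. sqrt (p i))\<^sup>2"
    using w0 by (simp add: power_mult_distrib)
  also have "\<dots> \<le> y / (1 + y) * (real d ^ 2 * x)"
    using wy S y by (intro mult_mono) auto
  also have "\<dots> \<le> 1 - \<delta> / 2"
  proof -
    have "y * (real d ^ 2 * x - (1 - \<delta> / 2)) \<le> 1 - \<delta> / 2"
      unfolding y_def by (rule subcritical_recursion_bound[OF d x1 \<delta> lam])
    then have "y * (real d ^ 2 * x) \<le> (1 - \<delta> / 2) * (1 + y)"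
      by (simp only: right_diff_distrib distrib_left mult_1_right mult.commute[of _ y])
    then have "y * (real d ^ 2 * x) / (1 + y) \<le> 1 - \<delta> / 2"
      using y by (subst pos_divide_le_eq) auto
    then show ?thesis by simp
  qed
  \<comment> \<open>Taking the square root halves the margin from \<open>\<delta> / 2\<close> to
    \<open>\<delta> / 4\<close>.\<close>
  also have "\<dots> \<le> (1 - \<delta> / 4)\<^sup>2" by (simp add: power2_eq_square algebra_simps)
  finally show ?thesis by (rule power2_le_imp_le) (use \<delta> in simp)
qed

text \<open>The critical fugacity decays like the inverse degree: it equals
  \<open>(1 + 1 / m) ^ d / m\<close> with \<open>m = d - 1\<close>, and \<open>d / m \<le> 2\<close>
  bounds the power by \<open>exp 2\<close>, which is below \<open>15 / 2\<close>.\<close>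

lemma hardcore_critical_le:
  assumes "d \<ge> 2"
  shows "hardcore_critical (Suc d) \<le> 15 / 2 / (real d - 1)"
proof -
  define m where "m = real d - 1"
  have m: "m \<ge> 1" using assms by (simp add: m_def)
  have "(1 + 1 / m) ^ d \<le> exp (1 / m) ^ d"
    using m by (intro power_mono exp_ge_add_one_self) auto
  also have "\<dots> = exp (real d / m)" by (simp add: exp_of_nat_mult[symmetric])
  also have "\<dots> \<le> exp 2"
    using assms by (simp add: m_def field_simps)
  also have "exp (2::real) = exp 1 * exp 1" by (simp add: exp_add[symmetric])
  also have "\<dots> \<le> 272 / 100 * (272 / 100)"
    using e_less_272 by (intro mult_mono) auto
  also have "\<dots> \<le> 15 / 2" by simp
  finally have *: "(1 + 1 / m) ^ d \<le> 15 / 2" .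
  have "hardcore_critical (Suc d) = (1 + 1 / m) ^ d / m"
  proof -
    have "1 + 1 / m = real d / m" using m by (simp add: m_def field_simps)
    then show ?thesis by (simp add: hardcore_critical_def m_def power_divide)
  qed
  also have "\<dots> \<le> 15 / 2 / m" using * m by (intro divide_right_mono) auto
  finally show ?thesis by (simp add: m_def)
qed

lemma critical_times_degree_le:
  assumes "d \<ge> 2" "0 < lam" "lam \<le> hardcore_critical (Suc d)"
  shows "real (Suc d) * (lam / (1 + lam)) \<le> 15 / 2"
proof -
  define m where "m = real d - 1"
  have m: "m \<ge> 1" using assms by (simp add: m_def)
  have "lam / (1 + lam) \<le> (15 / 2 / m) / (1 + 15 / 2 / m)"
    using assms hardcore_critical_le[of d] by (intro divide_one_plus_mono) (auto simp: m_def)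
  also have "\<dots> = (15 / 2) / (m + 15 / 2)" using m by (simp add: field_simps)
  finally have "real (Suc d) * (lam / (1 + lam)) \<le> real (Suc d) * ((15 / 2) / (m + 15 / 2))"
    by (intro mult_left_mono) auto
  also have "\<dots> = 15 / 2 * ((m + 2) / (m + 15 / 2))" by (simp add: m_def)
  also have "\<dots> \<le> 15 / 2 * 1" using m by (intro mult_left_mono) auto
  finally show ?thesis by simp
qed

section \<open>Influences through successive deletion of neighbours\<close>

context hardcore_weights
begin

definition nbrs :: "'v set \<Rightarrow> 'v \<Rightarrow> 'v set" where
  "nbrs V u = {v \<in> V. E u v}"

definition total_influence :: "'v set \<Rightarrow> 'v \<Rightarrow> real" where
  "total_influence V u = (\<Sum>v\<in>V. \<bar>jump V u (spin v)\<bar>)"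

lemma jump_spin_self: "finite V \<Longrightarrow> jump V u (spin u) = 1"
  using occ_outside[of u "V - {u}"] expct_const[of "V - nbhd u" 1]
  by (simp add: jump_def occ_def spin_def[abs_def])

lemma jump_spin_other:
  "v \<noteq> u \<Longrightarrow> jump V u (spin v) = occ (V - nbhd u) v - occ (V - {u}) v"
  by (simp add: jump_def occ_def spin_def[abs_def])

lemma jump_spin_outside: "v \<noteq> u \<Longrightarrow> v \<notin> V \<Longrightarrow> jump V u (spin v) = 0"
  by (simp add: jump_spin_other occ_outside)

lemma delete_nbrs:
  assumes "x ` {..<j} = nbrs V u"
  shows "V - {u} - x ` {..<j} = V - nbhd u"
  unfolding assms by (auto simp: nbrs_def nbhd_def)

lemma peel_mem:
  fixes x :: "nat \<Rightarrow> 'v"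
  assumes "bij_betw x {..<j} (nbrs V u)" "i < j"
  shows "x i \<in> V - {u} - x ` {..<i}"
proof -
  have "x i \<in> nbrs V u" using assms by (auto simp: bij_betw_def)
  moreover have "x i \<noteq> x k" if "k < i" for k
    using assms that by (auto simp: bij_betw_def dest: inj_onD[of x "{..<j}" i k])
  ultimately show ?thesis using E_irrefl by (auto simp: nbrs_def)
qed

lemma nbrs_mono: "V \<subseteq> V' \<Longrightarrow> nbrs V u \<subseteq> nbrs V' u"
  by (auto simp: nbrs_def)

lemma finite_nbrs: "finite V \<Longrightarrow> finite (nbrs V u)"
  by (simp add: nbrs_def)

lemma card_nbrs_mono: "finite V' \<Longrightarrow> V \<subseteq> V' \<Longrightarrow> card (nbrs V u) \<le> card (nbrs V' u)"
  by (intro card_mono nbrs_mono finite_nbrs)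

text \<open>The neighbour \<open>u\<close> of \<open>x i\<close> is already gone. This gain of one
  is what makes the contraction for \<open>d\<close> neighbours applicable below the root.\<close>

lemma peel_card_nbrs:
  fixes x :: "nat \<Rightarrow> 'v"
  assumes "finite V" "u \<in> V" "bij_betw x {..<j} (nbrs V u)" "i < j"
    and deg: "\<And>v. v \<in> V \<Longrightarrow> card (nbrs V v) \<le> Suc d"
  shows "card (nbrs (V - {u} - x ` {..<i}) (x i)) \<le> d"
proof -
  let ?G = "V - {u} - x ` {..<i}"
  have xu: "x i \<in> V" "E u (x i)" using assms by (auto simp: bij_betw_def nbrs_def)
  have "nbrs ?G (x i) \<subseteq> nbrs V (x i) - {u}" by (auto simp: nbrs_def)
  then have "card (nbrs ?G (x i)) \<le> card (nbrs V (x i) - {u})"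
    using assms finite_nbrs by (intro card_mono) auto
  also have "\<dots> = card (nbrs V (x i)) - 1"
    using assms xu E_sym by (intro card_Diff_singleton) (auto simp: nbrs_def)
  also have "\<dots> \<le> d" using deg[OF xu(1)] by simp
  finally show ?thesis .
qed

text \<open>Each factor \<open>1 - occ (G i) (x i)\<close> is
  \<open>Z (G (Suc i)) / Z (G i)\<close>, so the product telescopes from \<open>V - {u}\<close> down
  to \<open>V - nbhd u\<close>.\<close>

lemma occ_recursion:
  fixes x :: "nat \<Rightarrow> 'v"
  assumes V: "finite V" "u \<in> V" and x: "bij_betw x {..<j} (nbrs V u)"
  defines "G \<equiv> \<lambda>i. V - {u} - x ` {..<i}"
  defines "w \<equiv> lam * (\<Prod>i<j. 1 - occ (G i) (x i))"
  shows "occ V u = w / (1 + w)"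
proof -
  have fin: "finite (G i)" for i using V by (simp add: G_def)
  have mem: "x i \<in> G i" if "i < j" for i
    unfolding G_def by (rule peel_mem[OF x that])
  have Suc: "G (Suc i) = G i - {x i}" for i by (auto simp: G_def lessThan_Suc)
  have "(\<Prod>i<m. 1 - occ (G i) (x i)) = Z (G m) / Z (G 0)" if "m \<le> j" for m
    using that
  proof (induction m)
    case 0
    then show ?case using Z_pos[OF fin, of 0] by simp
  next
    case (Suc m)
    then show ?case
      using Z_pos[OF fin, of m] by (simp add: one_minus_occ_eq[OF fin mem] \<open>G (Suc m) = G m - {x m}\<close>)
  qed
  then have w: "w = lam * Z (V - nbhd u) / Z (V - {u})"
    using delete_nbrs[of x j V u] x by (simp add: w_def G_def bij_betw_def)
  have pos: "Z (V - {u}) > 0" "Z (V - nbhd u) > 0" using V by (simp_all add: Z_pos)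
  then have "1 + w = Z V / Z (V - {u})"
    unfolding w wsum_split[OF V, of "\<lambda>_. 1"] by (simp add: field_simps)
  then show ?thesis using pos by (simp add: w occ_eq[OF V])
qed

text \<open>Deleting the neighbours of \<open>u\<close> one at a time turns the influence of \<open>u\<close> into a sum of
  influences in smaller graphs; this plays the role of the self-avoiding walk tree.\<close>

lemma total_influence_recursion:
  fixes x :: "nat \<Rightarrow> 'v"
  assumes V: "finite V" "u \<in> V" and x: "bij_betw x {..<j} (nbrs V u)"
  defines "G \<equiv> \<lambda>i. V - {u} - x ` {..<i}"
  shows "total_influence V u \<le> 1 + (\<Sum>i<j. occ (G i) (x i) * total_influence (G i) (x i))"
proof -
  have fin: "finite (G i)" for i using V by (simp add: G_def)
  have mem: "x i \<in> G i" if "i < j" for i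
    unfolding G_def by (rule peel_mem[OF x that])
  have Suc: "G (Suc i) = G i - {x i}" for i by (auto simp: G_def lessThan_Suc)
  have "\<bar>jump V u (spin v)\<bar> \<le> (\<Sum>i<j. occ (G i) (x i) * \<bar>jump (G i) (x i) (spin v)\<bar>)"
    if "v \<noteq> u" for v
  proof -
    \<comment> \<open>\<open>G 0\<close> is \<open>u\<close> conditioned to be empty and
      \<open>G j\<close> is \<open>u\<close> conditioned to be occupied; the occupation of
      \<open>v\<close> is telescoped between them.\<close>
    have "occ (G i) v - occ (G (Suc i)) v = occ (G i) (x i) * jump (G i) (x i) (spin v)" if "i < j" for i
      unfolding occ_def[of _ v] Suc using expct_diff_delete[OF fin mem[OF that]] by simp
    then have "(\<Sum>i<j. occ (G i) (x i) * jump (G i) (x i) (spin v)) = occ (G 0) v - occ (G j) v"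
      using sum_lessThan_telescope'[of "\<lambda>i. occ (G i) v" j] by simp
    also have "\<dots> = - jump V u (spin v)"
      using delete_nbrs[of x j V u] x that by (simp add: jump_spin_other G_def bij_betw_def)
    finally have "\<bar>jump V u (spin v)\<bar> = \<bar>\<Sum>i<j. occ (G i) (x i) * jump (G i) (x i) (spin v)\<bar>"
      by simp
    also have "\<dots> \<le> (\<Sum>i<j. \<bar>occ (G i) (x i) * jump (G i) (x i) (spin v)\<bar>)" by (rule sum_abs)
    also have "\<dots> = (\<Sum>i<j. occ (G i) (x i) * \<bar>jump (G i) (x i) (spin v)\<bar>)"
      using occ_pos[OF fin mem] by (intro sum.cong) (auto simp: abs_mult less_imp_le)
    finally show ?thesis .
  qed
  then have "(\<Sum>v\<in>V - {u}. \<bar>jump V u (spin v)\<bar>) \<le>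
      (\<Sum>v\<in>V - {u}. \<Sum>i<j. occ (G i) (x i) * \<bar>jump (G i) (x i) (spin v)\<bar>)"
    by (intro sum_mono) auto
  also have "\<dots> = (\<Sum>i<j. occ (G i) (x i) * (\<Sum>v\<in>V - {u}. \<bar>jump (G i) (x i) (spin v)\<bar>))"
    by (subst sum.swap) (simp add: sum_distrib_left)
  also have "\<dots> = (\<Sum>i<j. occ (G i) (x i) * total_influence (G i) (x i))"
  proof (intro sum.cong refl arg_cong2[where f = "(*)"])
    fix i assume "i \<in> {..<j}"
    then have "x i \<in> G i" using mem by simp
    show "(\<Sum>v\<in>V - {u}. \<bar>jump (G i) (x i) (spin v)\<bar>) = total_influence (G i) (x i)"
      unfolding total_influence_def
    proof (rule sum.mono_neutral_right)
      show "\<forall>v\<in>V - {u} - G i. \<bar>jump (G i) (x i) (spin v)\<bar> = 0"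
        using jump_spin_outside[of _ "x i" "G i"] \<open>x i \<in> G i\<close> by (metis DiffD2 abs_0)
    qed (use V in \<open>auto simp: G_def\<close>)
  qed
  finally show ?thesis
    unfolding total_influence_def[of V] using V
    by (subst sum.remove[OF V]) (simp add: jump_spin_self)
qed

lemma total_influence_nonneg: "total_influence V u \<ge> 0"
  by (simp add: total_influence_def sum_nonneg)

lemma occ_le:
  assumes "finite V" "u \<in> V"
  shows "occ V u \<le> lam / (1 + lam)"
proof -
  have "indep (V - nbhd u) \<subseteq> indep (V - {u})" by (intro indep_mono) (auto simp: nbhd_def)
  then have "Z (V - nbhd u) \<le> Z (V - {u})"
    unfolding wsum_def using assms lam_pos finite_indep by (intro sum_mono2) auto
  then have "lam * Z (V - nbhd u) * 1 \<le> lam * Z (V - {u})"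
    using lam_pos by simp
  then show ?thesis
    using Z_pos[OF assms(1)] lam_pos wsum_split[OF assms, of "\<lambda>_. 1"]
    by (simp add: occ_eq[OF assms] field_simps)
qed

text \<open>With \<open>q = lam / (1 + lam)\<close>, the bound \<open>A\<close> solves
  \<open>A = sqrt q + (1 - \<delta> / 4) * A\<close>: one step of the recursion adds at most
  \<open>sqrt q\<close> and contracts the rest. The stricter degree condition at \<open>u\<close>
  alone is reproduced for each \<open>x i\<close> by \<open>peel_card_nbrs\<close>.\<close>

lemma total_influence_sqrt_occ_le:
  fixes \<delta> :: real
  assumes d: "d \<ge> 2" and \<delta>: "0 < \<delta>" "\<delta> < 1"
    and lam: "lam \<le> (1 - \<delta>) * hardcore_critical (Suc d)"
    and "finite V" "\<And>v. v \<in> V \<Longrightarrow> card (nbrs V v) \<le> Suc d" "u \<in> V" "card (nbrs V u) \<le> d"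
  shows "total_influence V u * sqrt (occ V u) \<le> 4 / \<delta> * sqrt (lam / (1 + lam))"
  using assms(5-)
proof (induction V arbitrary: u rule: finite_psubset_induct)
  case (psubset V)
  let ?A = "4 / \<delta> * sqrt (lam / (1 + lam))"
  have V: "finite V" "u \<in> V" using psubset by auto
  define j where "j = card (nbrs V u)"
  have j: "j \<le> d" using psubset.prems by (simp add: j_def)
  obtain x where x: "bij_betw x {..<j} (nbrs V u)"
    using ex_bij_betw_nat_finite[OF finite_nbrs[OF V(1)]] by (auto simp: j_def atLeast0LessThan)
  define G where "G i = V - {u} - x ` {..<i}" for i
  define p where "p i = occ (G i) (x i)" for i
  define w where "w = lam * (\<Prod>i<j. 1 - p i)"
  have fin: "finite (G i)" for i using V by (simp add: G_def)
  have mem: "x i \<in> G i" if "i < j" for i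
    unfolding G_def by (rule peel_mem[OF x that])
  have occ: "occ V u = w / (1 + w)"
    unfolding w_def p_def G_def by (rule occ_recursion[OF V x])
  have p: "0 < p i" "p i < 1" if "i < j" for i
    using occ_pos[OF fin mem[OF that]] occ_less_1[OF fin mem[OF that]] by (simp_all add: p_def)
  have IH: "total_influence (G i) (x i) * sqrt (p i) \<le> ?A" if i: "i < j" for i
    unfolding p_def
  proof (rule psubset.IH)
    show "G i \<subset> V" using V by (auto simp: G_def)
    show "card (nbrs (G i) v) \<le> Suc d" if "v \<in> G i" for v
      using card_nbrs_mono[OF V(1), of "G i" v] psubset.prems(1)[of v] that
      by (fastforce simp: G_def intro: order_trans)
    show "x i \<in> G i" by (rule mem[OF i])
    show "card (nbrs (G i) (x i)) \<le> d"
      unfolding G_def by (rule peel_card_nbrs[OF V x i psubset.prems(1)])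
  qed
  have "total_influence V u \<le> 1 + (\<Sum>i<j. p i * total_influence (G i) (x i))"
    unfolding p_def G_def by (rule total_influence_recursion[OF V x])
  also have "(\<Sum>i<j. p i * total_influence (G i) (x i)) \<le> (\<Sum>i<j. sqrt (p i) * ?A)"
  proof (rule sum_mono)
    fix i assume "i \<in> {..<j}"
    then have i: "i < j" by simp
    have "p i * total_influence (G i) (x i) = sqrt (p i) * (total_influence (G i) (x i) * sqrt (p i))"
      using p[OF i] by (simp add: algebra_simps flip: real_sqrt_mult)
    also have "\<dots> \<le> sqrt (p i) * ?A" using IH[OF i] p[OF i] by (intro mult_left_mono) auto
    finally show "p i * total_influence (G i) (x i) \<le> sqrt (p i) * ?A" .
  qed
  also have "(\<Sum>i<j. sqrt (p i) * ?A) = (\<Sum>i<j. sqrt (p i)) * ?A"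
    by (rule sum_distrib_right[symmetric])
  finally have T: "total_influence V u \<le> 1 + ?A * (\<Sum>i<j. sqrt (p i))" by (simp add: mult.commute)
  have contr: "sqrt (occ V u) * (\<Sum>i<j. sqrt (p i)) \<le> 1 - \<delta> / 4"
    unfolding occ using p less_imp_le
    by (intro subcritical_contraction[OF d j _ \<delta> lam_pos lam w_def]) blast
  have "total_influence V u * sqrt (occ V u) \<le> (1 + ?A * (\<Sum>i<j. sqrt (p i))) * sqrt (occ V u)"
    using T occ_pos[OF V] by (intro mult_right_mono) auto
  also have "\<dots> = sqrt (occ V u) + ?A * (sqrt (occ V u) * (\<Sum>i<j. sqrt (p i)))"
    by (simp add: algebra_simps)
  also have "\<dots> \<le> sqrt (lam / (1 + lam)) + ?A * (1 - \<delta> / 4)"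
    using occ_le[OF V] contr \<delta> lam_pos by (intro add_mono mult_left_mono) auto
  also have "\<dots> = ?A" using \<delta> by (simp add: field_simps)
  finally show ?case .
qed

text \<open>At a vertex with \<open>Suc d\<close> neighbours the contraction may fail, so the
  recursion is unrolled once and the previous bound used for the neighbours. Summing costs a factor
  \<open>Suc d\<close>, compensated by \<open>critical_times_degree_le\<close>.\<close>

lemma total_influence_le:
  fixes \<delta> :: real
  assumes d: "d \<ge> 2" and \<delta>: "0 < \<delta>" "\<delta> < 1"
    and lam: "lam \<le> (1 - \<delta>) * hardcore_critical (Suc d)"
    and V: "finite V" "u \<in> V" and deg: "\<And>v. v \<in> V \<Longrightarrow> card (nbrs V v) \<le> Suc d"
  shows "total_influence V u \<le> 32 / \<delta>"
proof -
  let ?A = "4 / \<delta> * sqrt (lam / (1 + lam))"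
  define j where "j = card (nbrs V u)"
  have j: "j \<le> Suc d" using deg[OF V(2)] by (simp add: j_def)
  obtain x where x: "bij_betw x {..<j} (nbrs V u)"
    using ex_bij_betw_nat_finite[OF finite_nbrs[OF V(1)]] by (auto simp: j_def atLeast0LessThan)
  define G where "G i = V - {u} - x ` {..<i}" for i
  have fin: "finite (G i)" for i using V by (simp add: G_def)
  have "occ (G i) (x i) * total_influence (G i) (x i) \<le> 4 / \<delta> * (lam / (1 + lam))" if i: "i < j" for i
  proof -
    have mem: "x i \<in> G i"
      unfolding G_def by (rule peel_mem[OF x that])
    have "total_influence (G i) (x i) * sqrt (occ (G i) (x i)) \<le> ?A"
    proof (rule total_influence_sqrt_occ_le[OF d \<delta> lam fin _ mem])
      show "card (nbrs (G i) v) \<le> Suc d" if "v \<in> G i" for v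
        using card_nbrs_mono[OF V(1), of "G i" v] deg[of v] that
        by (fastforce simp: G_def intro: order_trans)
      show "card (nbrs (G i) (x i)) \<le> d"
        unfolding G_def by (rule peel_card_nbrs[OF V x i deg])
    qed
    \<comment> \<open>Of the factor \<open>p\<close> in \<open>p * T\<close>, one root goes into the
      inductive bound and the other is at most \<open>sqrt (lam / (1 + lam))\<close>; together the
      roots give a full factor \<open>lam / (1 + lam)\<close>.\<close>
    from mult_mono[OF real_sqrt_le_mono[OF occ_le[OF fin mem]] this]
    have "sqrt (occ (G i) (x i)) * (total_influence (G i) (x i) * sqrt (occ (G i) (x i)))
        \<le> sqrt (lam / (1 + lam)) * ?A"
      using occ_pos[OF fin mem] lam_pos total_influence_nonneg[of "G i" "x i"] by simp
    then show ?thesis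
      using occ_pos[OF fin mem] lam_pos by (simp add: algebra_simps flip: real_sqrt_mult)
  qed
  then have "(\<Sum>i<j. occ (G i) (x i) * total_influence (G i) (x i)) \<le> real j * (4 / \<delta> * (lam / (1 + lam)))"
    using sum_mono[of "{..<j}" _ "\<lambda>_. 4 / \<delta> * (lam / (1 + lam))"] by simp
  also have "\<dots> \<le> real (Suc d) * (4 / \<delta> * (lam / (1 + lam)))"
    using j \<delta> lam_pos by (intro mult_right_mono) auto
  also have "\<dots> = 4 / \<delta> * (real (Suc d) * (lam / (1 + lam)))" by simp
  also have "\<dots> \<le> 4 / \<delta> * (15 / 2)"
  proof (intro mult_left_mono critical_times_degree_le[OF d lam_pos])
    have "hardcore_critical (Suc d) \<ge> 0" using d by (simp add: hardcore_critical_def)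
    then have "(1 - \<delta>) * hardcore_critical (Suc d) \<le> 1 * hardcore_critical (Suc d)"
      using \<delta> by (intro mult_right_mono) auto
    then show "lam \<le> hardcore_critical (Suc d)" using lam by simp
  qed (use \<delta> in simp)
  finally have "total_influence V u \<le> 1 + 30 / \<delta>"
    using total_influence_recursion[OF V x] by (simp add: G_def)
  also have "\<dots> \<le> 32 / \<delta>" using \<delta> by (simp add: field_simps)
  finally show ?thesis .
qed

end

section \<open>The Poincare inequality\<close>

text \<open>The growth factor \<open>(k - 1) / (k - \<eta>)\<close> is at most
  \<open>exp (\<eta> / k)\<close>, which is at most \<open>(k / (k - 1)) powr \<eta>\<close>. The
  first step is equivalent to \<open>\<eta>^2 \<le> k\<close>; the sharp exponent would be
  \<open>\<eta> - 1\<close>, and the spare 1 provides the room.\<close>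

lemma powr_growth_step:
  fixes k \<eta> :: real
  assumes "1 \<le> \<eta>" "\<eta> < k" "\<eta>\<^sup>2 \<le> k"
  shows "(k - 1) * (k - 1) powr \<eta> \<le> (k - \<eta>) * k powr \<eta>"
proof -
  have k: "k > 1" using assms by simp
  have "(k - 1) / (k - \<eta>) = 1 + (\<eta> - 1) / (k - \<eta>)" using assms by (simp add: field_simps)
  also have "\<dots> \<le> exp ((\<eta> - 1) / (k - \<eta>))" by (rule exp_ge_add_one_self)
  also have "\<dots> \<le> exp (\<eta> / k)"
    using assms k by (simp add: field_simps power2_eq_square)
  finally have 1: "(k - 1) / (k - \<eta>) \<le> exp (\<eta> / k)" .
  have "ln ((k - 1) / k) \<le> (k - 1) / k - 1" using k by (intro ln_le_minus_one) auto
  also have "\<dots> = - 1 / k" using k by (simp add: field_simps)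
  finally have "\<eta> * ln ((k - 1) / k) \<le> \<eta> * (- 1 / k)" using assms by (intro mult_left_mono) auto
  then have 2: "((k - 1) / k) powr \<eta> \<le> exp (- (\<eta> / k))" using k by (simp add: powr_def)
  have "(k - 1) / (k - \<eta>) * ((k - 1) / k) powr \<eta> \<le> exp (\<eta> / k) * exp (- (\<eta> / k))"
    using 1 2 by (intro mult_mono) auto
  also have "\<dots> = 1" by (simp flip: exp_add)
  finally have "(k - 1) / (k - \<eta>) * ((k - 1) powr \<eta> / k powr \<eta>) \<le> 1"
    using k by (simp add: powr_divide)
  then show ?thesis using k assms by (simp add: field_simps)
qed

context hardcore_weights
begin

text \<open>The left side sums the variances of the conditional expectations of \<open>f\<close>
  given one spin. By duality it is the covariance of \<open>f\<close> with a linear statistic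
  \<open>g\<close> of the spins, and the variance of \<open>g\<close> is controlled by the row sums
  of the influence matrix.\<close>

lemma spectral_independence:
  assumes V: "finite V" and \<eta>: "\<eta> > 0" and infl: "\<And>u. u \<in> V \<Longrightarrow> total_influence V u \<le> \<eta>"
  shows "(\<Sum>v\<in>V. occ V v * (1 - occ V v) * (jump V v f)\<^sup>2) \<le> \<eta> * cov V f f"
proof -
  define c where "c v = jump V v f" for v
  define K where "K u v = cov V (spin u) (spin v)" for u v
  define s where "s v = occ V v * (1 - occ V v)" for v
  define g where "g I = (\<Sum>v\<in>V. c v * spin v I)" for I
  define S where "S = (\<Sum>v\<in>V. s v * (c v)\<^sup>2)"
  have s: "s v \<ge> 0" if "v \<in> V" for v
    using occ_pos[OF V that] occ_less_1[OF V that] by (simp add: s_def)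
  have K: "K u v = s u * jump V u (spin v)" if "u \<in> V" for u v
    unfolding K_def s_def by (rule cov_spin[OF V that])
  have fg: "cov V f g = S"
  proof -
    have "cov V f g = (\<Sum>v\<in>V. c v * cov V f (spin v))"
      unfolding g_def by (simp add: cov_sum_right cov_cmult_right)
    also have "\<dots> = S"
      unfolding S_def
      by (rule sum.cong[OF refl])
        (simp add: cov_commute[of V f] cov_spin[OF V] c_def s_def power2_eq_square)
    finally show ?thesis .
  qed
  have "cov V g g = (\<Sum>u\<in>V. \<Sum>v\<in>V. c u * c v * K u v)"
    unfolding g_def K_def
    by (simp add: cov_sum_right cov_cmult_right cov_sum_left cov_cmult_left sum_distrib_left mult_ac
)
      (simp add: cov_commute mult_ac)
  \<comment> \<open>Symmetry of the covariance matrix then turns both halves into row sums, so no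
    eigenvalues are needed.\<close>
  also have "\<dots> \<le> (\<Sum>u\<in>V. \<Sum>v\<in>V. ((c u)\<^sup>2 / 2 + (c v)\<^sup>2 / 2) * \<bar>K u v\<bar>)"
  proof (intro sum_mono)
    fix u v
    have "(\<bar>c u\<bar> - \<bar>c v\<bar>)\<^sup>2 \<ge> 0" by simp
    then have "\<bar>c u * c v\<bar> \<le> (c u)\<^sup>2 / 2 + (c v)\<^sup>2 / 2"
      by (simp add: power2_diff abs_mult)
    then have "\<bar>c u * c v\<bar> * \<bar>K u v\<bar> \<le> ((c u)\<^sup>2 / 2 + (c v)\<^sup>2 / 2) * \<bar>K u v\<bar>"
      by (intro mult_right_mono) auto
    moreover have "c u * c v * K u v \<le> \<bar>c u * c v * K u v\<bar>" by (rule abs_ge_self)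
    ultimately show "c u * c v * K u v \<le> ((c u)\<^sup>2 / 2 + (c v)\<^sup>2 / 2) * \<bar>K u v\<bar>"
      by (simp add: abs_mult)
  qed
  also have "\<dots> = (\<Sum>u\<in>V. \<Sum>v\<in>V. (c u)\<^sup>2 / 2 * \<bar>K u v\<bar>) + (\<Sum>u\<in>V. \<Sum>v\<in>V. (c v)\<^sup>2 / 2 * \<bar>K u v\<bar>)"
    by (simp add: distrib_right sum.distrib)
  also have "(\<Sum>u\<in>V. \<Sum>v\<in>V. (c v)\<^sup>2 / 2 * \<bar>K u v\<bar>) = (\<Sum>u\<in>V. \<Sum>v\<in>V. (c u)\<^sup>2 / 2 * \<bar>K u v\<bar>)"
    by (subst sum.swap) (simp add: K_def cov_commute)
  also have "(\<Sum>u\<in>V. \<Sum>v\<in>V. (c u)\<^sup>2 / 2 * \<bar>K u v\<bar>) + (\<Sum>u\<in>V. \<Sum>v\<in>V. (c u)\<^sup>2 / 2 * \<bar>K u v\<bar>)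
      = (\<Sum>u\<in>V. (c u)\<^sup>2 * (\<Sum>v\<in>V. \<bar>K u v\<bar>))"
    by (simp add: sum_distrib_left mult_ac flip: sum.distrib)
  also have "\<dots> = (\<Sum>u\<in>V. (c u)\<^sup>2 * (s u * total_influence V u))"
    by (intro sum.cong refl)
      (simp add: K s abs_mult total_influence_def flip: sum_distrib_left)
  also have "\<dots> \<le> (\<Sum>u\<in>V. (c u)\<^sup>2 * (s u * \<eta>))"
    using infl s by (intro sum_mono mult_left_mono) auto
  also have "\<dots> = \<eta> * S" by (simp add: S_def sum_distrib_left mult_ac)
  finally have gg: "cov V g g \<le> \<eta> * S" .
  \<comment> \<open>Completing the square in place of Cauchy-Schwarz; the coefficient
    \<open>1 / \<eta>\<close> is the best one given \<open>gg\<close>.\<close>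
  let ?h = "\<lambda>I. f I - (1 / \<eta>) * g I"
  have "0 \<le> cov V ?h ?h" by (rule cov_self_nonneg[OF V])
  also have "\<dots> = cov V f f - 2 / \<eta> * S + (1 / \<eta>)\<^sup>2 * cov V g g"
    unfolding cov_diff_left cov_diff_right cov_cmult_left cov_cmult_right cov_commute[of V g f] fg
    by (simp add: power2_eq_square algebra_simps)
  also have "\<dots> \<le> cov V f f - 2 / \<eta> * S + (1 / \<eta>)\<^sup>2 * (\<eta> * S)"
    using gg by (intro add_left_mono mult_left_mono) auto
  also have "\<dots> = cov V f f - S / \<eta>" using \<eta> by (simp add: power2_eq_square)
  finally have "S \<le> \<eta> * cov V f f" using \<eta> by (simp add: field_simps)
  then show ?thesis by (simp add: S_def s_def c_def)
qed

text \<open>\<open>total_variance\<close> is summed over all \<open>v\<close>. The conditional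
  variances obey the induction hypothesis and their energies miss only the term at \<open>v\<close>,
  whence \<open>card V - 1\<close>; the remaining terms are at most
  \<open>\<eta> * cov V f f\<close> and move to the left.\<close>

lemma poincare_step:
  assumes V: "finite V" and \<eta>: "\<eta> > 0" and infl: "\<And>u. u \<in> V \<Longrightarrow> total_influence V u \<le> \<eta>"
    and IH: "\<And>U g. U \<subset> V \<Longrightarrow> cov U g g \<le> K * energy U g / Z U"
  shows "(real (card V) - \<eta>) * cov V f f \<le> K * (real (card V) - 1) * energy V f / Z V"
proof -
  have "occ V v * cov (V - nbhd v) (\<lambda>I. f (insert v I)) (\<lambda>I. f (insert v I))
      + (1 - occ V v) * cov (V - {v}) f f \<le> K / Z V * (energy V f - grad V v f)" if v: "v \<in> V" for v
  proof -
    let ?h = "\<lambda>I. f (insert v I)"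
    have sub: "V - nbhd v \<subset> V" "V - {v} \<subset> V" using v nbhd_self by auto
    have pos: "Z (V - nbhd v) > 0" "Z (V - {v}) > 0" "Z V > 0" using V by (simp_all add: Z_pos)
    have "occ V v * cov (V - nbhd v) ?h ?h \<le> occ V v * (K * energy (V - nbhd v) ?h / Z (V - nbhd v))"
      using occ_pos[OF V v] by (intro mult_left_mono IH sub) auto
    also have "\<dots> = K / Z V * (lam * energy (V - nbhd v) ?h)"
      using pos by (simp add: occ_eq[OF V v])
    finally have 1: "occ V v * cov (V - nbhd v) ?h ?h \<le> K / Z V * (lam * energy (V - nbhd v) ?h)" .
    have "(1 - occ V v) * cov (V - {v}) f f \<le> (1 - occ V v) * (K * energy (V - {v}) f / Z (V - {v}))"
      using occ_less_1[OF V v] by (intro mult_left_mono IH sub) auto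
    also have "\<dots> = K / Z V * energy (V - {v}) f"
      using pos by (simp add: one_minus_occ_eq[OF V v])
    finally have 2: "(1 - occ V v) * cov (V - {v}) f f \<le> K / Z V * energy (V - {v}) f" .
    have "K / Z V * (energy V f - grad V v f)
        = K / Z V * energy (V - {v}) f + K / Z V * (lam * energy (V - nbhd v) ?h)"
      unfolding energy_split[OF V v, symmetric] by (rule distrib_left)
    with 1 2 show ?thesis by linarith
  qed
  then have "cov V f f \<le> K / Z V * (energy V f - grad V v f) + occ V v * (1 - occ V v) * (jump V v f)\<^sup>2"
    if "v \<in> V" for v
    using that unfolding total_variance[OF V that, of f] by (intro add_right_mono) auto
  then have "(\<Sum>v\<in>V. cov V f f) \<le>
      (\<Sum>v\<in>V. K / Z V * (energy V f - grad V v f) + occ V v * (1 - occ V v) * (jump V v f)\<^sup>2)"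
    by (rule sum_mono)
  also have "\<dots> = K / Z V * (\<Sum>v\<in>V. energy V f - grad V v f)
      + (\<Sum>v\<in>V. occ V v * (1 - occ V v) * (jump V v f)\<^sup>2)"
    by (simp only: sum.distrib sum_distrib_left)
  also have "(\<Sum>v\<in>V. energy V f - grad V v f) = (real (card V) - 1) * energy V f"
    by (simp add: sum_subtractf energy_def[symmetric] algebra_simps)
  also have "K / Z V * ((real (card V) - 1) * energy V f)
      + (\<Sum>v\<in>V. occ V v * (1 - occ V v) * (jump V v f)\<^sup>2)
      \<le> K / Z V * ((real (card V) - 1) * energy V f) + \<eta> * cov V f f"
    by (intro add_left_mono spectral_independence[OF V \<eta> infl])
  finally show ?thesis by (simp add: left_diff_distrib mult.assoc)
qed

text \<open>Serves the small sets, where \<open>card V - \<eta>\<close> may be negative. Every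
  configuration is compared with the empty one by adding vertices one at a time; each vertex costs a
  factor \<open>2 * (1 + lam)\<close>.\<close>

lemma poincare_crude_wsum:
  assumes "finite V"
  shows "wsum V (\<lambda>I. (f I - f {})\<^sup>2) \<le> (2 * (1 + lam)) ^ card V * energy V f"
  using assms
proof (induction V arbitrary: f rule: finite_psubset_induct)
  case (psubset V)
  show ?case
  proof (cases "V = {}")
    case True
    have "indep {} = {{}}" by (auto simp: indep_def)
    with True show ?thesis by (simp add: wsum_def energy_def)
  next
    case False
    then obtain v where v: "v \<in> V" by blast
    have V: "finite V" by fact
    let ?h = "\<lambda>I. f (insert v I)"
    define k where "k = card V - 1"
    have k: "card V = Suc k" using V v card_gt_0_iff[of V] by (auto simp: k_def)
    define b where "b = (2 * (1 + lam)) ^ k"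
    have ck: "card (V - {v}) = k" using V v by (simp add: k_def)
    have "V - nbhd v \<subseteq> V - {v}" using nbhd_self by auto
    then have ck': "card (V - nbhd v) \<le> k" using card_mono[of "V - {v}" "V - nbhd v"] V ck by simp
    have mono: "(2 * (1 + lam)) ^ card (V - nbhd v) \<le> b"
      unfolding b_def using ck' lam_pos by (intro power_increasing) auto
    have sub: "V - nbhd v \<subset> V" "V - {v} \<subset> V" using v nbhd_self by auto
    have 1: "wsum (V - {v}) (\<lambda>I. (f I - f {})\<^sup>2) \<le> b * energy (V - {v}) f"
      using psubset.IH[OF sub(2), of f] by (simp add: ck b_def)
    have "wsum (V - nbhd v) (\<lambda>I. (?h I - ?h {})\<^sup>2)
        \<le> (2 * (1 + lam)) ^ card (V - nbhd v) * energy (V - nbhd v) ?h"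
      by (rule psubset.IH[OF sub(1)])
    also have "\<dots> \<le> b * energy (V - nbhd v) ?h"
      using mono energy_nonneg by (rule mult_right_mono)
    finally have 2: "wsum (V - nbhd v) (\<lambda>I. (?h I - ?h {})\<^sup>2) \<le> b * energy (V - nbhd v) ?h" .
    have "wsum (V - nbhd v) (\<lambda>I. (?h I - f {})\<^sup>2)
        \<le> wsum (V - nbhd v) (\<lambda>I. 2 * (?h I - ?h {})\<^sup>2 + 2 * (?h {} - f {})\<^sup>2)"
    proof (rule wsum_mono)
      fix I
      \<comment> \<open>Parallelogram law for \<open>?h I - ?h {}\<close> and
        \<open>?h {} - f {}\<close>; the second difference is a single term of
        \<open>grad V v f\<close>.\<close>
      have "(?h I - f {})\<^sup>2 + ((?h I - ?h {}) - (?h {} - f {}))\<^sup>2 =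
          2 * (?h I - ?h {})\<^sup>2 + 2 * (?h {} - f {})\<^sup>2"
        by (simp add: power2_eq_square algebra_simps)
      then show "(?h I - f {})\<^sup>2 \<le> 2 * (?h I - ?h {})\<^sup>2 + 2 * (?h {} - f {})\<^sup>2"
        using zero_le_power2[of "(?h I - ?h {}) - (?h {} - f {})"] by linarith
    qed
    also have "\<dots> = 2 * wsum (V - nbhd v) (\<lambda>I. (?h I - ?h {})\<^sup>2)
        + 2 * (?h {} - f {})\<^sup>2 * Z (V - nbhd v)"
      unfolding wsum_add wsum_cmult wsum_const[of _ "(?h {} - f {})\<^sup>2"] by simp
    also have "\<dots> \<le> 2 * (b * energy (V - nbhd v) ?h) + 2 * grad V v f * b"
    proof (intro add_mono mult_left_mono mult_mono 2)
      show "(?h {} - f {})\<^sup>2 \<le> grad V v f"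
      proof -
        have "lam ^ card ({}::'v set) * (f (insert v {}) - f {})\<^sup>2 \<le> grad V v f"
          unfolding grad_def wsum_def using V lam_pos empty_in_indep finite_indep
          by (intro member_le_sum) auto
        then show ?thesis by simp
      qed
      have "Z (V - nbhd v) \<le> (1 + lam) ^ card (V - nbhd v)" using V by (intro Z_le) auto
      also have "\<dots> \<le> (2 * (1 + lam)) ^ card (V - nbhd v)"
        using lam_pos by (intro power_mono) auto
      finally show "Z (V - nbhd v) \<le> b" using mono by linarith
    qed (use V grad_nonneg Z_pos[of "V - nbhd v"] in auto)
    finally have 3: "wsum (V - nbhd v) (\<lambda>I. (?h I - f {})\<^sup>2)
      \<le> 2 * (b * energy (V - nbhd v) ?h) + 2 * grad V v f * b" .
    have "wsum V (\<lambda>I. (f I - f {})\<^sup>2)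
        = wsum (V - {v}) (\<lambda>I. (f I - f {})\<^sup>2) + lam * wsum (V - nbhd v) (\<lambda>I. (?h I - f {})\<^sup>2)"
      by (rule wsum_split[OF V v])
    also have "\<dots> \<le> b * energy (V - {v}) f
        + lam * (2 * (b * energy (V - nbhd v) ?h) + 2 * grad V v f * b)"
      using 1 3 lam_pos by (intro add_mono mult_left_mono) auto
    \<comment> \<open>Doubling the first term gives both energies the same coefficient, so that
      \<open>energy_split\<close> recombines them.\<close>
    also have "\<dots> \<le> 2 * b * energy (V - {v}) f
        + lam * (2 * (b * energy (V - nbhd v) ?h) + 2 * grad V v f * b)"
      using energy_nonneg[of "V - {v}" f] lam_pos by (intro add_right_mono) (simp add: b_def)
    also have "\<dots> = 2 * b * (energy (V - {v}) f + lam * energy (V - nbhd v) ?h) + lam * (2 * b * grad V v f)"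
      by (simp add: algebra_simps)
    also have "\<dots> = 2 * b * (energy V f - grad V v f) + lam * (2 * b * grad V v f)"
      unfolding energy_split[OF V v] ..
    also have "\<dots> \<le> 2 * b * energy V f + lam * (2 * b * energy V f)"
    proof -
      have "grad V v f \<le> energy V f"
        unfolding energy_def using V v grad_nonneg by (intro member_le_sum) auto
      then show ?thesis
        using lam_pos grad_nonneg by (intro add_mono mult_left_mono) (auto simp: b_def)
    qed
    also have "\<dots> = (2 * (1 + lam)) ^ card V * energy V f"
      unfolding k by (simp add: b_def algebra_simps)
    finally show ?thesis .
  qed
qed

lemma poincare_crude:
  assumes "finite V"
  shows "cov V f f \<le> (2 * (1 + lam)) ^ card V * energy V f / Z V"
proof -
  have "cov V f f \<le> expct V (\<lambda>I. (f I - f {})\<^sup>2)" by (rule cov_self_le[OF assms])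
  also have "\<dots> \<le> (2 * (1 + lam)) ^ card V * energy V f / Z V"
    unfolding expct_def using Z_pos[OF assms] by (intro divide_right_mono poincare_crude_wsum assms) auto
  finally show ?thesis .
qed

lemma poincare:
  assumes "finite V" and \<eta>: "1 \<le> \<eta>" and m: "\<eta>\<^sup>2 \<le> real m"
    and "\<And>U u. U \<subseteq> V \<Longrightarrow> u \<in> U \<Longrightarrow> total_influence U u \<le> \<eta>"
  shows "cov V f f \<le> (2 * (1 + lam)) ^ m * real (card V) powr \<eta> * energy V f / Z V"
  using assms(1,4)
proof (induction V arbitrary: f rule: finite_psubset_induct)
  case (psubset V)
  have V: "finite V" by fact
  let ?M = "(2 * (1 + lam)) ^ m"
  have M: "?M > 0" using lam_pos by simp
  have E0: "energy V f / Z V \<ge> 0" using energy_nonneg Z_pos[OF V] by simp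
  show ?case
  proof (cases "card V \<le> m")
    case True
    show ?thesis
    \<comment> \<open>Here \<open>0 powr \<eta>\<close> is 0, so the factor is not at least 1; the
      energy vanishes as well.\<close>
    proof (cases "V = {}")
      case True
      then show ?thesis using poincare_crude[OF V, of f] by (simp add: energy_def)
    next
      case False
      then have "real (card V) \<ge> 1" using V card_gt_0_iff[of V] by (simp add: Suc_le_eq)
      then have "1 \<le> real (card V) powr \<eta>" using \<eta> by (intro ge_one_powr_ge_zero) auto
      moreover have "(2 * (1 + lam)) ^ card V \<le> ?M"
        using True lam_pos by (intro power_increasing) auto
      ultimately have "(2 * (1 + lam)) ^ card V * 1 \<le> ?M * real (card V) powr \<eta>"
        using M by (intro mult_mono) auto
      then have "(2 * (1 + lam)) ^ card V * (energy V f / Z V)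
          \<le> ?M * real (card V) powr \<eta> * (energy V f / Z V)"
        using E0 by (intro mult_right_mono) auto
      then show ?thesis using poincare_crude[OF V, of f] by simp
    qed
  next
    case False
    define k where "k = real (card V)"
    have k: "\<eta>\<^sup>2 < k" using False m by (simp add: k_def)
    have "\<eta> * 1 \<le> \<eta> * \<eta>" using \<eta> by (intro mult_left_mono) auto
    then have \<eta>k: "\<eta> < k" using k by (simp add: power2_eq_square)
    define K where "K = ?M * (k - 1) powr \<eta>"
    have "(k - \<eta>) * cov V f f \<le> K * (k - 1) * energy V f / Z V"
      unfolding k_def
    proof (rule poincare_step[OF V])
      fix U g assume U: "U \<subset> V"
      then have fU: "finite U" using V finite_subset by blast
      have "card U < card V" using U V by (simp add: psubset_card_mono)
      then have "real (card U) \<le> k - 1" by (simp add: k_def)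
      then have "?M * real (card U) powr \<eta> \<le> K"
        unfolding K_def using M \<eta> by (intro mult_left_mono powr_mono2) auto
      then have "?M * real (card U) powr \<eta> * (energy U g / Z U) \<le> K * (energy U g / Z U)"
        using energy_nonneg Z_pos[OF fU] by (intro mult_right_mono) auto
      moreover have "cov U g g \<le> ?M * real (card U) powr \<eta> * energy U g / Z U"
        using U by (intro psubset.IH psubset.prems) auto
      ultimately show "cov U g g \<le> K * energy U g / Z U" by simp
    qed (use \<eta> psubset.prems in auto)
    also have "\<dots> = ?M * ((k - 1) * (k - 1) powr \<eta>) * (energy V f / Z V)" by (simp add: K_def)
    also have "\<dots> \<le> ?M * ((k - \<eta>) * k powr \<eta>) * (energy V f / Z V)"
      using M E0 powr_growth_step[OF \<eta> \<eta>k] k by (intro mult_right_mono mult_left_mono) auto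
    also have "\<dots> = (k - \<eta>) * (?M * k powr \<eta> * energy V f / Z V)" by simp
    finally have "cov V f f \<le> ?M * k powr \<eta> * energy V f / Z V"
      by (rule mult_left_le_imp_le) (use \<eta>k in simp)
    then show ?thesis by (simp add: k_def)
  qed
qed

end

section \<open>The Glauber operator\<close>

context hardcore_weights
begin

definition heat_bath :: "'v \<Rightarrow> ('v set \<Rightarrow> real) \<Rightarrow> 'v set \<Rightarrow> real" where
  "heat_bath v f I = (if \<exists>u\<in>I. E u v then f (I - {v})
     else (lam * f (insert v I) + f (I - {v})) / (1 + lam))"

definition glauber_op :: "'v set \<Rightarrow> ('v set \<Rightarrow> real) \<Rightarrow> 'v set \<Rightarrow> real" where
  "glauber_op V f I = (\<Sum>v\<in>V. heat_bath v f I) / real (card V)"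

text \<open>Sorted as the heat bath at \<open>v\<close> acts: configurations with an occupied
  neighbour of \<open>v\<close> are fixed, all others form pairs \<open>A\<close>,
  \<open>insert v A\<close> that are averaged.\<close>

lemma wsum_split_blocked:
  assumes "finite V" "v \<in> V"
  shows "wsum V g = wsum (V - nbhd v) (\<lambda>A. g A + lam * g (insert v A))
    + (\<Sum>I | I \<in> indep V \<and> (\<exists>u\<in>I. E u v). lam ^ card I * g I)"
proof -
  let ?B = "{I \<in> indep V. \<exists>u\<in>I. E u v}"
  have "indep (V - {v}) = indep (V - nbhd v) \<union> ?B"
  proof (intro equalityI subsetI)
    fix I assume "I \<in> indep (V - {v})"
    then show "I \<in> indep (V - nbhd v) \<union> ?B"
      using E_sym by (auto simp: indep_def nbhd_def)
  next
    fix I assume "I \<in> indep (V - nbhd v) \<union> ?B"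
    then show "I \<in> indep (V - {v})" by (auto simp: indep_def nbhd_def)
  qed
  then have "wsum (V - {v}) g = wsum (V - nbhd v) g + (\<Sum>I\<in>?B. lam ^ card I * g I)"
    unfolding wsum_def using assms finite_indep E_sym
    by (simp, subst sum.union_disjoint) (auto simp: indep_def nbhd_def)
  then show ?thesis
    unfolding wsum_split[OF assms, of g] wsum_add wsum_cmult by simp
qed

lemma heat_bath_blocked:
  assumes "I \<in> indep V" "\<exists>u\<in>I. E u v"
  shows "heat_bath v f I = f I"
proof -
  have "v \<notin> I" using assms by (auto simp: indep_def)
  with assms(2) show ?thesis by (simp add: heat_bath_def)
qed

lemma heat_bath_free:
  assumes "A \<in> indep (V - nbhd v)"
  shows "heat_bath v f A = (lam * f (insert v A) + f A) / (1 + lam)"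
    and "heat_bath v f (insert v A) = (lam * f (insert v A) + f A) / (1 + lam)"
proof -
  have "v \<notin> A" "\<not> (\<exists>u\<in>A. E u v)" "\<not> (\<exists>u\<in>insert v A. E u v)"
    using assms E_sym E_irrefl by (auto simp: indep_def nbhd_def)
  then show "heat_bath v f A = (lam * f (insert v A) + f A) / (1 + lam)"
    "heat_bath v f (insert v A) = (lam * f (insert v A) + f A) / (1 + lam)"
    by (simp_all add: heat_bath_def)
qed

lemma wsum_blocked_heat_bath:
  "(\<Sum>I | I \<in> indep V \<and> (\<exists>u\<in>I. E u v). lam ^ card I * F (heat_bath v f I))
    = (\<Sum>I | I \<in> indep V \<and> (\<exists>u\<in>I. E u v). lam ^ card I * F (f I))"
proof (rule sum.cong[OF refl])
  fix I assume "I \<in> {I. I \<in> indep V \<and> (\<exists>u\<in>I. E u v)}"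
  then have "heat_bath v f I = f I" using heat_bath_blocked by blast
  then show "lam ^ card I * F (heat_bath v f I) = lam ^ card I * F (f I)" by simp
qed

lemma wsum_heat_bath:
  assumes "finite V" "v \<in> V"
  shows "wsum V (heat_bath v f) = wsum V f"
proof -
  have average: "x / (1 + lam) + lam * (x / (1 + lam)) = x" for x
  proof -
    have "x / (1 + lam) + lam * (x / (1 + lam)) = (1 + lam) * (x / (1 + lam))"
      by (simp only: distrib_right mult_1_left)
    then show ?thesis using lam_pos by simp
  qed
  have "wsum (V - nbhd v) (\<lambda>A. heat_bath v f A + lam * heat_bath v f (insert v A))
      = wsum (V - nbhd v) (\<lambda>A. f A + lam * f (insert v A))"
  proof (rule wsum_cong)
    fix A assume A: "A \<in> indep (V - nbhd v)"
    show "heat_bath v f A + lam * heat_bath v f (insert v A) = f A + lam * f (insert v A)"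
      unfolding heat_bath_free[OF A] average by simp
  qed
  then show ?thesis
    unfolding wsum_split_blocked[OF assms, of "heat_bath v f"] wsum_split_blocked[OF assms, of f]
    by (simp add: wsum_blocked_heat_bath[where F = "\<lambda>x. x"])
qed

text \<open>Averaging over a pair removes exactly its conditional variance from the second
  moment.\<close>

lemma wsum_heat_bath_square:
  assumes "finite V" "v \<in> V"
  shows "wsum V (\<lambda>I. (heat_bath v f I)\<^sup>2) = wsum V (\<lambda>I. (f I)\<^sup>2) - lam / (1 + lam) * grad V v f"
proof -
  have "wsum (V - nbhd v) (\<lambda>A. (heat_bath v f A)\<^sup>2 + lam * (heat_bath v f (insert v A))\<^sup>2)
      = wsum (V - nbhd v) (\<lambda>A. ((f A)\<^sup>2 + lam * (f (insert v A))\<^sup>2)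
          - lam / (1 + lam) * (f (insert v A) - f A)\<^sup>2)"
  proof (rule wsum_cong)
    fix A assume A: "A \<in> indep (V - nbhd v)"
    define a b c where "a = f A" and "b = f (insert v A)" and "c = 1 + lam"
    have c: "c \<noteq> 0" and lam: "lam = c - 1" using lam_pos by (simp_all add: c_def)
    have "((lam * b + a) / c)\<^sup>2 + lam * ((lam * b + a) / c)\<^sup>2 = (lam * b + a)\<^sup>2 / c"
      using c by (simp add: lam power2_eq_square field_simps)
    also have "\<dots> = a\<^sup>2 + lam * b\<^sup>2 - lam / c * (b - a)\<^sup>2"
      using c by (simp add: lam power2_eq_square field_simps)
    finally show "(heat_bath v f A)\<^sup>2 + lam * (heat_bath v f (insert v A))\<^sup>2 =
        ((f A)\<^sup>2 + lam * (f (insert v A))\<^sup>2) - lam / (1 + lam) * (f (insert v A) - f A)\<^sup>2"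
      unfolding heat_bath_free[OF A] by (simp add: a_def b_def c_def)
  qed
  then show ?thesis
    unfolding wsum_split_blocked[OF assms, of "\<lambda>I. (heat_bath v f I)\<^sup>2"]
      wsum_split_blocked[OF assms, of "\<lambda>I. (f I)\<^sup>2"] grad_def
      wsum_blocked_heat_bath[where F = "\<lambda>x. x\<^sup>2"]
    by (simp only: wsum_diff wsum_cmult)
qed

lemma expct_glauber_op:
  assumes "finite V" "V \<noteq> {}"
  shows "expct V (glauber_op V f) = expct V f"
proof -
  have "wsum V (glauber_op V f) = wsum V (\<lambda>I. 1 / real (card V) * (\<Sum>v\<in>V. heat_bath v f I))"
    by (simp add: glauber_op_def[abs_def])
  also have "\<dots> = 1 / real (card V) * (\<Sum>v\<in>V. wsum V (heat_bath v f))"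
    by (simp only: wsum_cmult wsum_sum)
  also have "\<dots> = wsum V f" using assms by (simp add: wsum_heat_bath)
  finally show ?thesis by (simp add: expct_def)
qed

text \<open>The square of the average over \<open>v\<close> is at most the average of the squares,
  so the losses of the single heat baths add up to the Dirichlet form. This gives decay of variance
  directly, without a spectral decomposition.\<close>

lemma cov_glauber_op_le:
  assumes V: "finite V" "V \<noteq> {}"
  shows "cov V (glauber_op V f) (glauber_op V f)
    \<le> cov V f f - lam / ((1 + lam) * real (card V)) * energy V f / Z V"
proof -
  define n where "n = real (card V)"
  have n: "n > 0" using V by (simp add: n_def card_gt_0_iff)
  have "wsum V (\<lambda>I. (glauber_op V f I)\<^sup>2) \<le> wsum V (\<lambda>I. 1 / n * (\<Sum>v\<in>V. (heat_bath v f I)\<^sup>2))"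
  proof (rule wsum_mono)
    fix I
    have "(\<Sum>v\<in>V. heat_bath v f I)\<^sup>2 \<le> (\<Sum>v\<in>V. (heat_bath v f I)\<^sup>2) * n"
      unfolding n_def by (rule sum_squared_le_sum_of_squares)
    then show "(glauber_op V f I)\<^sup>2 \<le> 1 / n * (\<Sum>v\<in>V. (heat_bath v f I)\<^sup>2)"
      using n by (simp add: glauber_op_def n_def[symmetric] power_divide)
        (simp add: field_simps power2_eq_square)
  qed
  also have "\<dots> = 1 / n * (\<Sum>v\<in>V. wsum V (\<lambda>I. (f I)\<^sup>2) - lam / (1 + lam) * grad V v f)"
    unfolding wsum_cmult wsum_sum
    by (intro arg_cong2[where f = "(*)"] sum.cong refl wsum_heat_bath_square V)
  also have "\<dots> = wsum V (\<lambda>I. (f I)\<^sup>2) - lam / ((1 + lam) * n) * energy V f"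
  proof -
    have "(\<Sum>v\<in>V. wsum V (\<lambda>I. (f I)\<^sup>2) - lam / (1 + lam) * grad V v f)
        = n * wsum V (\<lambda>I. (f I)\<^sup>2) - lam / (1 + lam) * energy V f"
      by (simp add: sum_subtractf n_def energy_def sum_distrib_left)
    then show ?thesis using n by (simp add: right_diff_distrib)
  qed
  finally have "wsum V (\<lambda>I. (glauber_op V f I)\<^sup>2) / Z V
      \<le> (wsum V (\<lambda>I. (f I)\<^sup>2) - lam / ((1 + lam) * n) * energy V f) / Z V"
    using Z_pos[OF V(1)] by (intro divide_right_mono) auto
  then have "expct V (\<lambda>I. (glauber_op V f I)\<^sup>2)
      \<le> expct V (\<lambda>I. (f I)\<^sup>2) - lam / ((1 + lam) * n) * energy V f / Z V"
    unfolding expct_def by (simp only: diff_divide_distrib)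
  then show ?thesis
    unfolding cov_def expct_glauber_op[OF V] n_def by (simp add: power2_eq_square)
qed

lemma cov_glauber_op_funpow_le:
  assumes V: "finite V" "V \<noteq> {}" and K: "K > 0"
    and poincare: "\<And>g. cov V g g \<le> K * energy V g / Z V"
  shows "cov V ((glauber_op V ^^ t) f) ((glauber_op V ^^ t) f)
    \<le> exp (- real t * (lam / ((1 + lam) * real (card V) * K))) * cov V f f"
proof (induction t)
  case 0
  then show ?case by simp
next
  case (Suc t)
  define \<gamma> where "\<gamma> = lam / ((1 + lam) * real (card V) * K)"
  define g where "g = (glauber_op V ^^ t) f"
  have n: "real (card V) > 0" using V by (simp add: card_gt_0_iff)
  have "\<gamma> * cov V g g \<le> \<gamma> * (K * energy V g / Z V)"
    unfolding \<gamma>_def using lam_pos K n by (intro mult_left_mono poincare) auto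
  also have "\<dots> = lam / ((1 + lam) * real (card V)) * energy V g / Z V"
    using K by (simp add: \<gamma>_def)
  finally have "cov V (glauber_op V g) (glauber_op V g) \<le> (1 - \<gamma>) * cov V g g"
    using cov_glauber_op_le[OF V, of g] by (simp add: algebra_simps)
  also have "\<dots> \<le> exp (- \<gamma>) * cov V g g"
    using exp_ge_add_one_self[of "- \<gamma>"] cov_self_nonneg[OF V(1)] by (intro mult_right_mono) auto
  also have "\<dots> \<le> exp (- \<gamma>) * (exp (- real t * \<gamma>) * cov V f f)"
    using Suc.IH by (intro mult_left_mono) (auto simp: g_def \<gamma>_def)
  also have "\<dots> = exp (- real (Suc t) * \<gamma>) * cov V f f"
    by (simp add: exp_add[symmetric] algebra_simps)
  finally show ?case by (simp add: g_def \<gamma>_def)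
qed

lemma expct_glauber_op_funpow:
  "finite V \<Longrightarrow> V \<noteq> {} \<Longrightarrow> expct V ((glauber_op V ^^ t) f) = expct V f"
  by (induction t) (simp_all add: expct_glauber_op)

text \<open>A single atom contributes at most the whole variance; its inverse mass is the price of a
  worst-case start.\<close>

lemma pointwise_le_cov:
  assumes "finite V" "x \<in> indep V"
  shows "lam ^ card x / Z V * (f x - expct V f)\<^sup>2 \<le> cov V f f"
proof -
  have "lam ^ card x * (f x - expct V f)\<^sup>2 \<le> wsum V (\<lambda>I. (f I - expct V f)\<^sup>2)"
    unfolding wsum_def using assms finite_indep lam_pos by (intro member_le_sum) auto
  then have "lam ^ card x * (f x - expct V f)\<^sup>2 / Z V \<le> expct V (\<lambda>I. (f I - expct V f)\<^sup>2)"
    unfolding expct_def[of V "\<lambda>I. (f I - _)\<^sup>2"] using Z_pos[OF assms(1)] by (intro divide_right_mono) auto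
  then show ?thesis using cov_self_centered[OF assms(1), of f "expct V f"] by simp
qed

section \<open>Contraction of Lipschitz constants\<close>

definition lipschitz :: "'v set \<Rightarrow> real \<Rightarrow> ('v set \<Rightarrow> real) \<Rightarrow> bool" where
  "lipschitz V L f \<longleftrightarrow>
     (\<forall>v A. v \<in> V \<longrightarrow> v \<notin> A \<longrightarrow> insert v A \<in> indep V \<longrightarrow> \<bar>f (insert v A) - f A\<bar> \<le> L)"

lemma lipschitzD:
  "lipschitz V L f \<Longrightarrow> v \<in> V \<Longrightarrow> v \<notin> A \<Longrightarrow> insert v A \<in> indep V \<Longrightarrow> \<bar>f (insert v A) - f A\<bar> \<le> L"
  by (simp add: lipschitz_def)

lemma indep_subset: "I \<in> indep V \<Longrightarrow> J \<subseteq> I \<Longrightarrow> J \<in> indep V"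
  by (auto simp: indep_def)

text \<open>Path coupling in dual form, for states that differ at \<open>v\<close> only. Updating
  \<open>v\<close> removes the difference. Updating a neighbour \<open>w\<close> may create a new
  one, since \<open>v\<close> blocks \<open>w\<close> in one state while in the other
  \<open>w\<close> is occupied with probability at most \<open>lam / (1 + lam)\<close>. Any other
  update can be coupled identically.\<close>

lemma heat_bath_lipschitz:
  assumes f: "lipschitz V L f" and L: "L \<ge> 0" and v: "v \<in> V" "v \<notin> A" "insert v A \<in> indep V"
    and w: "w \<in> V"
  shows "\<bar>heat_bath w f (insert v A) - heat_bath w f A\<bar>
    \<le> L * of_bool (w \<noteq> v) + lam / (1 + lam) * L * of_bool (E v w)"
proof -
  define q where "q = lam / (1 + lam)"
  have q: "0 \<le> q" "q \<le> 1" using lam_pos by (simp_all add: q_def)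
  have avg: "(lam * a + b) / (1 + lam) = q * a + (1 - q) * b" for a b
  proof -
    have "1 - q = 1 / (1 + lam)" using lam_pos by (simp add: q_def field_simps)
    then show ?thesis by (simp add: q_def add_divide_distrib)
  qed
  have insw: "insert w B \<in> indep V" if "B \<in> indep V" "\<not> (\<exists>u\<in>B. E u w)" for B
    using that w E_sym E_irrefl by (auto simp: indep_def)
  consider "w = v" | "w \<noteq> v" "E v w" | "w \<noteq> v" "\<not> E v w" by blast
  then show ?thesis
  proof cases
    case 1
    have "A \<in> indep (V - nbhd v)" using insert_in_indep_iff[OF v(1,2)] v(3) by simp
    then show ?thesis using 1 heat_bath_free[of A V v f] E_irrefl L lam_pos by simp
  next
    case 2
    have wB: "w \<notin> insert v A" using v(3) 2 by (auto simp: indep_def)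
    have B: "heat_bath w f (insert v A) = f (insert v A)"
      by (rule heat_bath_blocked[OF v(3)]) (use 2 in blast)
    have d1: "\<bar>f (insert v A) - f A\<bar> \<le> L" by (rule lipschitzD[OF f v])
    have A: "A \<in> indep V" using indep_subset[OF v(3)] by blast
    show ?thesis
    proof (cases "\<exists>u\<in>A. E u w")
      case True
      then have "heat_bath w f A = f A" by (rule heat_bath_blocked[OF A])
      then show ?thesis
        unfolding q_def[symmetric] using d1 B 2 mult_nonneg_nonneg[OF q(1) L] by simp
    next
      case False
      then have "\<bar>f (insert w A) - f A\<bar> \<le> L"
        using wB by (intro lipschitzD[OF f w] insw[OF A]) auto
      then have "\<bar>q * (f (insert w A) - f A)\<bar> \<le> q * L"
        using q by (simp add: abs_mult mult_left_mono)
      moreover have "heat_bath w f A = f A + q * (f (insert w A) - f A)"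
        using False wB by (simp add: heat_bath_def avg) (simp add: algebra_simps)
      ultimately show ?thesis unfolding q_def[symmetric] using d1 B 2 by simp
    qed
  next
    case 3
    have bl: "(\<exists>u\<in>insert v A. E u w) \<longleftrightarrow> (\<exists>u\<in>A. E u w)" using 3 by auto
    have ins: "insert v A - {w} = insert v (A - {w})" using 3 by auto
    have "insert v (A - {w}) \<in> indep V" by (rule indep_subset[OF v(3)]) auto
    then have d2: "\<bar>f (insert v A - {w}) - f (A - {w})\<bar> \<le> L"
      unfolding ins using v by (intro lipschitzD[OF f v(1)]) auto
    show ?thesis
    proof (cases "\<exists>u\<in>A. E u w")
      case True
      then show ?thesis using d2 bl 3 by (simp add: heat_bath_def)
    next
      case False
      have "insert v (insert w A) \<in> indep V"
        using insw[OF v(3)] False bl by (simp add: insert_commute)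
      then have d1: "\<bar>f (insert w (insert v A)) - f (insert w A)\<bar> \<le> L"
        using lipschitzD[OF f v(1), of "insert w A"] v 3 by (simp add: insert_commute)
      have "heat_bath w f (insert v A) - heat_bath w f A =
          q * (f (insert w (insert v A)) - f (insert w A))
          + (1 - q) * (f (insert v A - {w}) - f (A - {w}))"
        using False bl by (simp add: heat_bath_def avg) (simp add: algebra_simps)
      also have "\<bar>\<dots>\<bar> \<le> q * L + (1 - q) * L"
        using d1 d2 q
        by (intro order_trans[OF abs_triangle_ineq] add_mono) (auto simp: abs_mult mult_left_mono)
      finally show ?thesis using 3 by (simp add: algebra_simps)
    qed
  qed
qed

text \<open>One choice out of \<open>card V\<close> gains a full \<open>L\<close>, and the
  neighbours of \<open>v\<close> together give back at most half of it.\<close>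

lemma glauber_op_lipschitz:
  assumes f: "lipschitz V L f" and L: "L \<ge> 0" and V: "finite V"
    and deg: "\<And>v. v \<in> V \<Longrightarrow> real (card (nbrs V v)) * (lam / (1 + lam)) \<le> 1 / 2"
  shows "lipschitz V ((1 - 1 / (2 * real (card V))) * L) (glauber_op V f)"
  unfolding lipschitz_def
proof (intro allI impI)
  fix v A assume v: "v \<in> V" "v \<notin> A" "insert v A \<in> indep V"
  define n where "n = real (card V)"
  have n: "n > 0" using V v by (auto simp: n_def card_gt_0_iff)
  define q where "q = lam / (1 + lam)"
  have "\<bar>glauber_op V f (insert v A) - glauber_op V f A\<bar>
      = \<bar>\<Sum>w\<in>V. heat_bath w f (insert v A) - heat_bath w f A\<bar> / n"
    using n by (simp add: glauber_op_def n_def sum_subtractf flip: diff_divide_distrib)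
  also have "\<dots> \<le> (\<Sum>w\<in>V. L * of_bool (w \<noteq> v) + q * L * of_bool (E v w)) / n"
    unfolding q_def using n
    by (intro divide_right_mono order_trans[OF sum_abs] sum_mono heat_bath_lipschitz[OF f L v]) auto
  also have "(\<Sum>w\<in>V. L * of_bool (w \<noteq> v) + q * L * of_bool (E v w))
      = L * (\<Sum>w\<in>V. of_bool (w \<noteq> v)) + q * L * (\<Sum>w\<in>V. of_bool (E v w))"
    by (simp add: sum.distrib sum_distrib_left)
  also have "(\<Sum>w\<in>V. of_bool (w \<noteq> v)) = n - 1"
  proof -
    have "(\<Sum>w\<in>V. of_bool (w \<noteq> v)) = (\<Sum>w\<in>V. (1::real) - of_bool (w = v))"
      by (rule sum.cong) auto
    also have "\<dots> = n - 1" using V v(1) by (simp add: sum_subtractf n_def of_bool_def)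
    finally show ?thesis .
  qed
  also have "(\<Sum>w\<in>V. of_bool (E v w)) = real (card (nbrs V v))"
    using V by (simp add: nbrs_def of_bool_def sum.If_cases Int_def)
  also have "(L * (n - 1) + q * L * real (card (nbrs V v))) / n \<le> (L * (n - 1) + L * (1 / 2)) / n"
  proof -
    have "L * (real (card (nbrs V v)) * q) \<le> L * (1 / 2)"
      unfolding q_def using L deg[OF v(1)] by (intro mult_left_mono) auto
    then show ?thesis using n by (intro divide_right_mono) (auto simp: mult_ac)
  qed
  also have "\<dots> = (1 - 1 / (2 * n)) * L" using n by (simp add: field_simps)
  finally show "\<bar>glauber_op V f (insert v A) - glauber_op V f A\<bar> \<le> (1 - 1 / (2 * real (card V))) * L"
    by (simp add: n_def)
qed

lemma glauber_op_funpow_lipschitz: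
  assumes f: "lipschitz V L f" and L: "L \<ge> 0" and V: "finite V" "V \<noteq> {}"
    and deg: "\<And>v. v \<in> V \<Longrightarrow> real (card (nbrs V v)) * (lam / (1 + lam)) \<le> 1 / 2"
  shows "lipschitz V ((1 - 1 / (2 * real (card V))) ^ t * L) ((glauber_op V ^^ t) f)"
proof (induction t)
  case 0
  then show ?case using f by simp
next
  case (Suc t)
  have "real (card V) \<ge> 1" using V by (simp add: card_gt_0_iff Suc_le_eq)
  then have "1 - 1 / (2 * real (card V)) \<ge> 0" by (simp add: field_simps)
  then have "(1 - 1 / (2 * real (card V))) ^ t * L \<ge> 0" using L by simp
  from glauber_op_lipschitz[OF Suc this V(1) deg] show ?case by (simp add: mult_ac)
qed

text \<open>Subsets of independent sets are independent, so \<open>{}\<close> is reached through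
  admissible one-vertex steps.\<close>

lemma lipschitz_diff_empty:
  assumes f: "lipschitz V L f" and "finite V" "I \<in> indep V"
  shows "\<bar>f I - f {}\<bar> \<le> real (card I) * L"
proof -
  have "finite I" using assms by (auto simp: indep_def intro: finite_subset)
  then show ?thesis using assms(3)
  proof (induction I)
    case empty
    then show ?case by simp
  next
    case (insert v A)
    have "A \<in> indep V" using insert.prems by (rule indep_subset) auto
    then have "\<bar>f A - f {}\<bar> \<le> real (card A) * L" by (rule insert.IH)
    moreover have "\<bar>f (insert v A) - f A\<bar> \<le> L"
      using insert by (intro lipschitzD[OF f]) (auto simp: indep_def)
    ultimately show ?case using insert.hyps by (simp add: distrib_right)
  qed
qed

lemma lipschitz_diff_expct:
  assumes f: "lipschitz V L f" and V: "finite V" and L: "L \<ge> 0" and x: "x \<in> indep V"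
  shows "\<bar>f x - expct V f\<bar> \<le> 2 * real (card V) * L"
proof -
  have b: "\<bar>f I - f {}\<bar> \<le> real (card V) * L" if "I \<in> indep V" for I
  proof -
    have "card I \<le> card V" using that V by (auto simp: indep_def intro: card_mono)
    then have "real (card I) * L \<le> real (card V) * L" using L by (intro mult_right_mono) auto
    with lipschitz_diff_empty[OF f V that] show ?thesis by simp
  qed
  have "expct V f \<le> expct V (\<lambda>_. f {} + real (card V) * L)"
    using b by (intro expct_mono[OF V]) (fastforce simp: abs_le_iff)
  moreover have "expct V (\<lambda>_. f {} - real (card V) * L) \<le> expct V f"
    using b by (intro expct_mono[OF V]) (fastforce simp: abs_le_iff)
  ultimately have "\<bar>expct V f - f {}\<bar> \<le> real (card V) * L"
    using V by (simp add: expct_const abs_le_iff)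
  with b[OF x] show ?thesis by linarith
qed

end

section \<open>Mixing times\<close>

text \<open>\<open>P\<close> is known to match the kernel on \<open>\<Omega>\<close> only, so the
  chain must stay there. The chain takes its new step last whereas \<open>P\<close> then acts on
  \<open>f\<close> first; hence the induction is over all \<open>f\<close>.\<close>

lemma expectation_chain_dist:
  fixes P :: "('s \<Rightarrow> real) \<Rightarrow> 's \<Rightarrow> real"
  assumes fin: "finite \<Omega>" and closed: "\<And>x. x \<in> \<Omega> \<Longrightarrow> set_pmf (K x) \<subseteq> \<Omega>"
    and P: "\<And>f x. x \<in> \<Omega> \<Longrightarrow> measure_pmf.expectation (K x) f = P f x" and x: "x \<in> \<Omega>"
  shows "measure_pmf.expectation (chain_dist K t x) f = (P ^^ t) f x"
proof -
  have sub: "set_pmf (chain_dist K t x) \<subseteq> \<Omega>" for t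
    by (induction t) (use x closed in \<open>auto simp: chain_dist_def\<close>)
  show ?thesis
  proof (induction t arbitrary: f)
    case 0
    then show ?case by (simp add: chain_dist_def)
  next
    case (Suc t)
    have "chain_dist K (Suc t) x = bind_pmf (chain_dist K t x) K" by (simp add: chain_dist_def)
    then have "measure_pmf.expectation (chain_dist K (Suc t) x) f
        = (\<Sum>y\<in>\<Omega>. pmf (chain_dist K t x) y * measure_pmf.expectation (K y) f)"
      using pmf_expectation_bind[OF fin _ sub, of K t f] finite_subset[OF closed fin] by simp
    also have "\<dots> = (\<Sum>y\<in>\<Omega>. pmf (chain_dist K t x) y * P f y)" by (simp add: P)
    also have "\<dots> = measure_pmf.expectation (chain_dist K t x) (P f)"
      by (subst integral_measure_pmf[OF fin]) (use sub in auto)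
    also have "\<dots> = (P ^^ Suc t) f x" by (simp add: Suc.IH funpow_swap1)
    finally show ?case .
  qed
qed

text \<open>The infimum ranges over single times, so one time that is good for all starts suffices,
  without monotonicity of the distance.\<close>

lemma mixing_time_le:
  assumes "\<And>x. x \<in> \<Omega> \<Longrightarrow> tv_dist (chain_dist K t x) \<mu> \<le> 1 / 4"
  shows "mixing_time \<Omega> K \<mu> \<le> enat t"
  unfolding mixing_time_def by (intro SUP_least INF_lower) (use assms in simp)

lemma tv_dist_le:
  fixes \<epsilon> :: real
  assumes "\<And>A. \<bar>measure_pmf.expectation p (indicator A) - measure_pmf.expectation q (indicator A)\<bar> \<le> \<epsilon>"
  shows "tv_dist p q \<le> \<epsilon>"
  unfolding tv_dist_def by (rule cSUP_least) (use assms in auto)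

section \<open>Transfer to the Glauber chain of a graph\<close>

locale hardcore_graph =
  fixes G :: "'v pair_pre_digraph" and lam :: real
  assumes graph: "pair_graph G" and fugacity_pos: "lam > 0"

sublocale hardcore_graph \<subseteq> hardcore_weights "\<lambda>u v. (u, v) \<in> parcs G" lam
proof
  interpret pair_graph G by (rule graph)
  show "(u, v) \<in> parcs G \<Longrightarrow> (v, u) \<in> parcs G" for u v
    using pair_sym_arcs by (auto simp: symmetric_def dest: symD)
  show "(v, v) \<notin> parcs G" for v using pair_no_loops by force
qed (rule fugacity_pos)

context hardcore_graph
begin

abbreviation "V \<equiv> pverts G"

lemma finite_V: "finite V"
proof -
  interpret pair_graph G by (rule graph)
  show ?thesis by (rule pair_finite_verts)
qed

lemma independent_sets_eq: "independent_sets G = indep V"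
  by (simp add: independent_sets_def indep_def)

lemma partition_function_eq: "partition_function G lam = Z V"
  by (simp add: partition_function_def wsum_def independent_sets_eq)

lemma expectation_hardcore: "measure_pmf.expectation (hardcore G lam) f = expct V f"
proof -
  have "measure_pmf.expectation (hardcore G lam) f = (\<Sum>I\<in>indep V. pmf (hardcore G lam) I * f I)"
    using integral_measure_pmf[OF finite_indep[OF finite_V], of "hardcore G lam" f]
      set_pmf_hardcore[OF graph fugacity_pos] by (simp add: independent_sets_eq)
  also have "\<dots> = (\<Sum>I\<in>indep V. lam ^ card I * f I / Z V)"
    by (rule sum.cong)
      (simp_all add: pmf_hardcore[OF graph fugacity_pos] independent_sets_eq partition_function_eq)
  finally show ?thesis by (simp add: expct_def wsum_def sum_divide_distrib)
qed

lemma expectation_cond_hardcore: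
  assumes "I \<in> indep V" "v \<in> V"
  shows "measure_pmf.expectation (cond_pmf (hardcore G lam) {J. J - {v} = I - {v}}) f = heat_bath v f I"
    and "set_pmf (cond_pmf (hardcore G lam) {J. J - {v} = I - {v}}) \<subseteq> indep V"
proof -
  define p where "p = lam / (1 + lam)"
  have p: "0 \<le> p" "p \<le> 1" "1 - p = 1 / (1 + lam)"
    using fugacity_pos by (simp_all add: p_def field_simps)
  show "measure_pmf.expectation (cond_pmf (hardcore G lam) {J. J - {v} = I - {v}}) f = heat_bath v f I"
    unfolding cond_hardcore_eq[OF graph fugacity_pos assms[folded independent_sets_eq]] heat_bath_def
    using p by (simp add: p_def[symmetric] integral_map_pmf mult.commute)
      (simp add: p_def add_divide_distrib)
  have "I \<in> set_pmf (hardcore G lam)"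
    using assms set_pmf_hardcore[OF graph fugacity_pos] by (simp add: independent_sets_eq)
  then have "set_pmf (hardcore G lam) \<inter> {J. J - {v} = I - {v}} \<noteq> {}" by blast
  then show "set_pmf (cond_pmf (hardcore G lam) {J. J - {v} = I - {v}}) \<subseteq> indep V"
    using set_pmf_hardcore[OF graph fugacity_pos] by (simp add: set_cond_pmf independent_sets_eq)
qed

lemma expectation_glauber:
  assumes "V \<noteq> {}" "I \<in> indep V"
  shows "measure_pmf.expectation (glauber G lam I) f = glauber_op V f I"
    and "set_pmf (glauber G lam I) \<subseteq> indep V"
proof -
  let ?C = "\<lambda>v. cond_pmf (hardcore G lam) {J. J - {v} = I - {v}}"
  have set: "set_pmf (pmf_of_set V) = V" using assms finite_V by simp
  have fin: "finite (set_pmf (?C v))" if "v \<in> V" for v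
    using finite_subset[OF expectation_cond_hardcore(2)[OF assms(2) that] finite_indep[OF finite_V]] .
  have "measure_pmf.expectation (glauber G lam I) f
      = (\<Sum>v\<in>V. pmf (pmf_of_set V) v * measure_pmf.expectation (?C v) f)"
    unfolding glauber_def
    by (subst pmf_expectation_bind[OF finite_V fin]) (use set in simp_all)
  also have "\<dots> = (\<Sum>v\<in>V. heat_bath v f I / real (card V))"
    using assms finite_V by (intro sum.cong) (simp_all add: expectation_cond_hardcore(1))
  finally show "measure_pmf.expectation (glauber G lam I) f = glauber_op V f I"
    by (simp add: glauber_op_def sum_divide_distrib)
  show "set_pmf (glauber G lam I) \<subseteq> indep V"
    unfolding glauber_def using expectation_cond_hardcore(2)[OF assms(2)] set by auto
qed

lemma glauber_mixing_time_le:
  assumes "V \<noteq> {}"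
    and "\<And>x A. x \<in> indep V \<Longrightarrow>
      \<bar>(glauber_op V ^^ t) (indicator A) x - expct V (indicator A)\<bar> \<le> 1 / 4"
  shows "mixing_time (independent_sets G) (glauber G lam) (hardcore G lam) \<le> enat t"
proof (intro mixing_time_le tv_dist_le)
  fix x A assume "x \<in> independent_sets G"
  then have x: "x \<in> indep V" by (simp add: independent_sets_eq)
  have "measure_pmf.expectation (chain_dist (glauber G lam) t x) (indicator A)
      = (glauber_op V ^^ t) (indicator A) x"
    using assms(1) x expectation_glauber
    by (intro expectation_chain_dist[OF finite_indep[OF finite_V]]) auto
  then show "\<bar>measure_pmf.expectation (chain_dist (glauber G lam) t x) (indicator A)
      - measure_pmf.expectation (hardcore G lam) (indicator A)\<bar> \<le> (1 / 4 :: real)"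
    using assms(2)[OF x, of A] by (simp only: expectation_hardcore)
qed

text \<open>The kernel would draw from the empty set, but the only state is already stationary at
  time 0. The value must be exactly 0, as the final bound vanishes for \<open>n = 0\<close>.\<close>

lemma mixing_time_empty_graph:
  assumes "V = {}"
  shows "mixing_time (independent_sets G) (glauber G lam) (hardcore G lam) = 0"
proof -
  have ind: "independent_sets G = {{}}" using assms by (auto simp: independent_sets_def)
  then have "hardcore G lam = return_pmf {}"
    using set_pmf_hardcore[OF graph fugacity_pos]
    by (intro iffD1[OF set_pmf_subset_singleton]) simp
  then have "mixing_time (independent_sets G) (glauber G lam) (hardcore G lam) \<le> enat 0"
    by (intro mixing_time_le tv_dist_le) (simp add: ind chain_dist_def)
  then show ?thesis by (simp flip: zero_enat_def)
qed

lemma card_nbrs_le_max_degree: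
  assumes "v \<in> V"
  shows "card (nbrs V v) \<le> max_degree G"
proof -
  interpret pair_graph G by (rule graph)
  have "card (nbrs V v) = card (Pair v ` nbrs V v)" by (simp add: card_image inj_on_def)
  also have "\<dots> \<le> card (out_arcs (with_proj G) v)"
    by (rule card_mono) (auto simp: nbrs_def out_arcs_def)
  also have "\<dots> \<le> max_degree G"
    unfolding max_degree_def out_degree_def[symmetric] using assms finite_V by (intro Max_ge) auto
  finally show ?thesis .
qed

lemma mixing_time_le_if_sparse:
  assumes V: "V \<noteq> {}" and lam: "real (max_degree G) * lam \<le> 1 / 2"
  shows "mixing_time (independent_sets G) (glauber G lam) (hardcore G lam) \<le> enat (16 * card V ^ 2)"
proof (rule glauber_mixing_time_le[OF V])
  fix x A assume x: "x \<in> indep V"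
  define n where "n = real (card V)"
  have n: "n \<ge> 1" using V finite_V by (simp add: n_def card_gt_0_iff Suc_le_eq)
  \<comment> \<open>A factor \<open>1 - 1 / (2 * n)\<close> per step gives
    \<open>exp (- (8 * n))\<close> after \<open>t\<close> steps, which outweighs the diameter factor
    \<open>2 * n\<close>. Order \<open>n * ln n\<close> would do, but the square fits the target
    exponent.\<close>
  define t where "t = 16 * card V ^ 2"
  define r where "r = 1 - 1 / (2 * n)"
  have r: "r \<ge> 0" using n by (simp add: r_def field_simps)
  have "lipschitz V 1 (indicator A)" by (auto simp: lipschitz_def indicator_def)
  then have "lipschitz V (r ^ t * 1) ((glauber_op V ^^ t) (indicator A))"
    unfolding r_def n_def
  proof (rule glauber_op_funpow_lipschitz[OF _ _ finite_V V])
    fix v assume "v \<in> V"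
    have "lam / (1 + lam) \<le> lam" using fugacity_pos by (simp add: field_simps)
    then have "real (card (nbrs V v)) * (lam / (1 + lam)) \<le> real (max_degree G) * lam"
      using card_nbrs_le_max_degree[OF \<open>v \<in> V\<close>] fugacity_pos by (intro mult_mono) auto
    with lam show "real (card (nbrs V v)) * (lam / (1 + lam)) \<le> 1 / 2" by linarith
  qed simp
  then have "\<bar>(glauber_op V ^^ t) (indicator A) x - expct V ((glauber_op V ^^ t) (indicator A))\<bar>
      \<le> 2 * real (card V) * (r ^ t * 1)"
    using r x by (intro lipschitz_diff_expct finite_V) auto
  also have "expct V ((glauber_op V ^^ t) (indicator A)) = expct V (indicator A)"
    by (rule expct_glauber_op_funpow[OF finite_V V])
  also have "2 * real (card V) * (r ^ t * 1) = 2 * n * r ^ t" by (simp add: n_def)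
  also have "\<dots> \<le> 1 / 4"
  proof -
    have "r ^ t \<le> exp (- (1 / (2 * n))) ^ t"
      unfolding r_def[symmetric] using r exp_ge_add_one_self[of "- (1 / (2 * n))"]
      by (intro power_mono) (auto simp: r_def)
    also have "\<dots> = exp (- (8 * n))"
      using n by (simp add: t_def n_def[symmetric] power2_eq_square flip: exp_of_nat_mult)
    also have "\<dots> \<le> 1 / (8 * n)"
    proof -
      have "8 * n \<le> exp (8 * n)" using exp_ge_add_one_self[of "8 * n"] by linarith
      then show ?thesis using n by (simp add: exp_minus field_simps)
    qed
    finally have "2 * n * r ^ t \<le> 2 * n * (1 / (8 * n))" using n by (intro mult_left_mono) auto
    then show ?thesis using n by simp
  qed
  finally show "\<bar>(glauber_op V ^^ t) (indicator A) x - expct V (indicator A)\<bar> \<le> 1 / 4" .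
qed

text \<open>\<open>R\<close> serves to bound every probability from below by
  \<open>1 / R ^ n\<close>. The \<open>ln 16\<close> brings the squared deviation below
  \<open>1 / 16\<close>, so that the deviation itself is at most \<open>1 / 4\<close>.\<close>

lemma mixing_time_le_if_poincare:
  assumes V: "V \<noteq> {}" and K: "K > 0" and poincare: "\<And>g. cov V g g \<le> K * energy V g / Z V"
    and R: "R \<ge> 1" "1 + lam \<le> R * lam" "1 + lam \<le> R"
    and t: "(1 + lam) / lam * real (card V) * K * (ln 16 + real (card V) * ln R) \<le> real t"
  shows "mixing_time (independent_sets G) (glauber G lam) (hardcore G lam) \<le> enat t"
proof (rule glauber_mixing_time_le[OF V])
  fix x A assume x: "x \<in> indep V"
  define n where "n = card V"
  have n: "n > 0" using V finite_V by (simp add: n_def card_gt_0_iff)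
  let ?f = "indicator A :: 'v set \<Rightarrow> real"
  define g where "g = (glauber_op V ^^ t) ?f"
  define \<gamma> where "\<gamma> = lam / ((1 + lam) * real n * K)"
  define d where "d = g x - expct V g"
  have "ln 16 + real n * ln R \<le> real t * \<gamma>"
  proof -
    have "(ln 16 + real n * ln R) / \<gamma> = (1 + lam) / lam * real n * K * (ln 16 + real n * ln R)"
      using fugacity_pos by (simp add: \<gamma>_def)
    moreover have "\<gamma> > 0" using fugacity_pos K n by (simp add: \<gamma>_def)
    ultimately show ?thesis
      using t pos_divide_le_eq[of \<gamma> "ln 16 + real n * ln R" "real t"] by (simp only: n_def)
  qed
  then have "exp (- real t * \<gamma>) \<le> exp (- ln 16 + real n * (- ln R))" by simp
  also have "\<dots> = 1 / (16 * R ^ n)"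
    using R by (simp add: exp_add exp_diff exp_minus exp_of_nat_mult field_simps)
  finally have e: "exp (- real t * \<gamma>) \<le> 1 / (16 * R ^ n)" .
  have "cov V ?f ?f \<le> expct V (\<lambda>I. (?f I - 0)\<^sup>2)" by (rule cov_self_le[OF finite_V])
  also have "\<dots> \<le> expct V (\<lambda>I. 1)" by (rule expct_mono[OF finite_V]) (simp add: indicator_def)
  also have "\<dots> = 1" by (rule expct_const[OF finite_V])
  finally have cov1: "cov V ?f ?f \<le> 1" .
  have "lam ^ card x / Z V * d\<^sup>2 \<le> cov V g g"
    unfolding d_def by (rule pointwise_le_cov[OF finite_V x])
  also have "\<dots> \<le> exp (- real t * \<gamma>) * cov V ?f ?f"
    unfolding g_def \<gamma>_def n_def by (rule cov_glauber_op_funpow_le[OF finite_V V K poincare])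
  also have "\<dots> \<le> 1 / (16 * R ^ n) * 1"
    using e cov1 R cov_self_nonneg[OF finite_V] by (intro mult_mono) auto
  finally have 1: "lam ^ card x / Z V * d\<^sup>2 \<le> 1 / (16 * R ^ n)" by simp
  \<comment> \<open>Each vertex accounts for one factor \<open>1 + lam\<close> of the bound on
    \<open>Z V\<close>: an occupied one is charged \<open>R * lam\<close>, an empty one
    \<open>R\<close>.\<close>
  have "1 / R ^ n \<le> lam ^ card x / Z V"
  proof -
    have cx: "card x \<le> n" using x finite_V by (auto simp: n_def indep_def intro: card_mono)
    have "Z V \<le> (1 + lam) ^ n" unfolding n_def by (rule Z_le[OF finite_V])
    also have "\<dots> = (1 + lam) ^ card x * (1 + lam) ^ (n - card x)"
      using cx by (simp flip: power_add)
    also have "\<dots> \<le> (R * lam) ^ card x * R ^ (n - card x)"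
      using R fugacity_pos by (intro mult_mono power_mono) auto
    also have "\<dots> = lam ^ card x * (R ^ card x * R ^ (n - card x))" by (simp add: power_mult_distrib)
    also have "\<dots> = lam ^ card x * R ^ n" using cx by (simp flip: power_add)
    finally show ?thesis using Z_pos[OF finite_V] R by (simp add: field_simps)
  qed
  then have "1 / R ^ n * d\<^sup>2 \<le> lam ^ card x / Z V * d\<^sup>2" by (intro mult_right_mono) auto
  with 1 have "1 / R ^ n * d\<^sup>2 \<le> 1 / (16 * R ^ n)" by linarith
  then have "d\<^sup>2 \<le> (1 / 4)\<^sup>2" using R by (simp add: field_simps power2_eq_square)
  then have "\<bar>d\<bar> \<le> 1 / 4" by (simp add: abs_le_square_iff[symmetric])
  then show "\<bar>(glauber_op V ^^ t) ?f x - expct V ?f\<bar> \<le> 1 / 4"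
    using expct_glauber_op_funpow[OF finite_V V, of t ?f] by (simp add: d_def g_def)
qed

end

theorem theorem1:
  fixes \<Delta> :: nat and \<delta> :: real
  assumes "\<Delta> \<ge> 3" and "0 < \<delta>" and "\<delta> < 1"
  shows "\<exists>C::real. \<forall>(G :: 'v pair_pre_digraph) (n::nat) (lam::real).
    pair_graph G \<and> card (pverts G) = n \<and> max_degree G = \<Delta> \<and>
    0 < lam \<and> lam \<le> (1 - \<delta>) * hardcore_critical \<Delta> \<longrightarrow>
      ereal_of_enat (mixing_time (independent_sets G) (glauber G lam) (hardcore G lam))
        \<le> ereal (C * real n powr (2 + 32 / \<delta>))"
proof -
  define \<eta> where "\<eta> = 32 / \<delta>"
  define L where "L = hardcore_critical \<Delta>"
  define m where "m = nat \<lceil>\<eta>\<^sup>2\<rceil>"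
  \<comment> \<open>\<open>M\<close>, \<open>R\<close> and \<open>C1\<close> use the largest
    admissible value \<open>L\<close> in place of \<open>lam\<close>, and
    \<open>2 * \<Delta> + 1\<close> in place of \<open>(1 + lam) / lam\<close>, to be uniform in
    \<open>lam\<close>.\<close>
  define M where "M = (2 * (1 + L)) ^ m"
  define R where "R = (1 + L) * (2 * real \<Delta> + 1)"
  define C1 where "C1 = (2 * real \<Delta> + 1) * M * (ln 16 + ln R)"
  have \<eta>: "\<eta> \<ge> 1" using assms by (simp add: \<eta>_def field_simps)
  have m: "\<eta>\<^sup>2 \<le> real m" by (simp add: m_def)
  obtain d where d: "\<Delta> = Suc d" "d \<ge> 2" using assms(1) by (cases \<Delta>) auto
  have L: "L \<ge> 0" using assms(1) by (simp add: L_def hardcore_critical_def)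
  have M: "M \<ge> 1" using L by (simp add: M_def one_le_power)
  have "1 * 1 \<le> R" unfolding R_def using L by (intro mult_mono) auto
  then have R: "R \<ge> 1" by simp
  have C1: "C1 \<ge> 0" using M R by (simp add: C1_def)
  \<comment> \<open>In \<open>C1 + 17\<close>, 16 covers the sparse case and 1 the rounding of
    \<open>T\<close> to an integer.\<close>
  have bound: "ereal_of_enat (mixing_time (independent_sets G) (glauber G lam) (hardcore G lam))
        \<le> ereal ((C1 + 17) * real (card (pverts G)) powr (2 + \<eta>))"
    if G: "pair_graph G" "max_degree G = \<Delta>" "0 < lam" "lam \<le> (1 - \<delta>) * hardcore_critical \<Delta>"
    for G :: "'v pair_pre_digraph" and lam
  proof -
    interpret hardcore_graph G lam by (rule hardcore_graph.intro) (use G in auto)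
    define n where "n = real (card V)"
    show ?thesis
    proof (cases "V = {}")
      case True
      then show ?thesis by (simp add: mixing_time_empty_graph)
    next
      case V: False
      have n: "n \<ge> 1" using V finite_V by (simp add: n_def card_gt_0_iff Suc_le_eq)
      have nge: "1 \<le> n powr (2 + \<eta>)" using n \<eta> by (intro ge_one_powr_ge_zero) auto
      obtain t where t: "mixing_time (independent_sets G) (glauber G lam) (hardcore G lam) \<le> enat t"
        "real t \<le> (C1 + 17) * n powr (2 + \<eta>)"
      proof (cases "real \<Delta> * lam \<le> 1 / 2")
        case True
        show thesis
        proof (rule that)
          show "mixing_time (independent_sets G) (glauber G lam) (hardcore G lam)
              \<le> enat (16 * card V ^ 2)"
            using True G by (intro mixing_time_le_if_sparse V) simp
          have "real (16 * card V ^ 2) = 16 * n powr 2" using n by (simp add: n_def)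
          also have "\<dots> \<le> (C1 + 17) * n powr (2 + \<eta>)"
            using n \<eta> C1 by (intro mult_mono powr_mono) auto
          finally show "real (16 * card V ^ 2) \<le> (C1 + 17) * n powr (2 + \<eta>)" .
        qed
      next
        case False
        have lamL: "lam \<le> L"
        proof -
          have "(1 - \<delta>) * L \<le> 1 * L" using L assms by (intro mult_right_mono) auto
          with G show ?thesis by (simp add: L_def)
        qed
        \<comment> \<open>This is where the failure of \<open>\<Delta> * lam \<le> 1 / 2\<close> is
          used: it keeps \<open>lam\<close> away from 0.\<close>
        have inv: "(1 + lam) / lam \<le> 2 * real \<Delta> + 1"
          using False fugacity_pos by (simp add: field_simps)
        define K where "K = M * n powr \<eta>"
        have K: "K > 0" using M n by (simp add: K_def)
        have poin: "cov V g g \<le> K * energy V g / Z V" for g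
        proof -
          have "total_influence U u \<le> \<eta>" if "U \<subseteq> V" "u \<in> U" for U u
            unfolding \<eta>_def
          proof (rule total_influence_le[OF d(2)])
            show "lam \<le> (1 - \<delta>) * hardcore_critical (Suc d)" using G d by simp
            show "finite U" using finite_subset[OF that(1) finite_V] .
            show "card (nbrs U v) \<le> Suc d" if "v \<in> U" for v
              using card_nbrs_mono[OF finite_V \<open>U \<subseteq> V\<close>, of v] card_nbrs_le_max_degree[of v]
                that \<open>U \<subseteq> V\<close> G d by fastforce
          qed (use assms that in auto)
          then have "cov V g g \<le> (2 * (1 + lam)) ^ m * n powr \<eta> * energy V g / Z V"
            unfolding n_def by (intro poincare finite_V \<eta> m) auto
          also have "\<dots> = (2 * (1 + lam)) ^ m * (n powr \<eta> * energy V g / Z V)" by simp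
          also have "\<dots> \<le> M * (n powr \<eta> * energy V g / Z V)"
            unfolding M_def using lamL fugacity_pos energy_nonneg Z_pos[OF finite_V]
            by (intro mult_right_mono power_mono) auto
          finally show ?thesis by (simp add: K_def)
        qed
        define T where "T = (1 + lam) / lam * n * K * (ln 16 + n * ln R)"
        have "T \<le> (2 * real \<Delta> + 1) * n * K * (n * (ln 16 + ln R))"
        proof -
          have "1 * ln 16 \<le> n * ln (16::real)" using n by (intro mult_right_mono) auto
          then have "ln 16 + n * ln R \<le> n * (ln 16 + ln R)" by (simp add: distrib_left)
          then show ?thesis
            unfolding T_def using inv n K R fugacity_pos by (intro mult_mono mult_nonneg_nonneg) auto
        qed
        also have "\<dots> = C1 * (n * n * n powr \<eta>)" by (simp add: C1_def K_def)
        also have "n * n * n powr \<eta> = n powr (2 + \<eta>)"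
          using n by (simp add: powr_add power2_eq_square)
        finally have T: "T \<le> C1 * n powr (2 + \<eta>)" .
        have T0: "T \<ge> 0" using n K R fugacity_pos by (simp add: T_def)
        show thesis
        proof (rule that)
          show "mixing_time (independent_sets G) (glauber G lam) (hardcore G lam) \<le> enat (nat \<lceil>T\<rceil>)"
          proof (rule mixing_time_le_if_poincare[OF V K poin R])
            show "1 + lam \<le> R * lam"
            proof -
              have "1 + lam \<le> (2 * real \<Delta> + 1) * lam"
                using inv fugacity_pos by (simp add: pos_divide_le_eq)
              also have "\<dots> = 1 * ((2 * real \<Delta> + 1) * lam)" by simp
              also have "\<dots> \<le> (1 + L) * ((2 * real \<Delta> + 1) * lam)"
                using L fugacity_pos by (intro mult_right_mono) auto
              finally show ?thesis by (simp add: R_def mult.assoc)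
            qed
            have "(1 + lam) * 1 \<le> (1 + L) * (2 * real \<Delta> + 1)"
              using lamL L by (intro mult_mono) auto
            then show "1 + lam \<le> R" by (simp add: R_def)
            have "T \<le> real (nat \<lceil>T\<rceil>)" by (rule real_nat_ceiling_ge)
            then show "(1 + lam) / lam * real (card V) * K * (ln 16 + real (card V) * ln R)
                \<le> real (nat \<lceil>T\<rceil>)" by (simp add: T_def n_def)
          qed
          have "real (nat \<lceil>T\<rceil>) \<le> T + 1" using T0 by linarith
          also have "\<dots> \<le> C1 * n powr (2 + \<eta>) + 17 * n powr (2 + \<eta>)"
            using T nge by linarith
          finally show "real (nat \<lceil>T\<rceil>) \<le> (C1 + 17) * n powr (2 + \<eta>)" by (simp add: distrib_right)
        qed
      qed
      have "ereal_of_enat (mixing_time (independent_sets G) (glauber G lam) (hardcore G lam))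
          \<le> ereal_of_enat (enat t)"
        using t(1) by (simp only: ereal_of_enat_le_iff)
      also have "\<dots> \<le> ereal ((C1 + 17) * n powr (2 + \<eta>))" using t(2) by simp
      finally show ?thesis by (simp add: n_def)
    qed
  qed
  show ?thesis
    by (rule exI[of _ "C1 + 17"]) (use bound in \<open>auto simp: \<eta>_def\<close>)
qed

end
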